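(* Let $X$ be a $d$-dimensional Banach space, let $E=(x_1,\dots,x_n,-x_1,\dots,-x_n)$ be a direction set in $X$, and let $\alpha=(\alpha_1,\dots,\alpha_n)>0$ be an $E$-admissible multiindex. Then there exists a complete, symmetric, simplicial $E$-fan $\mathcal{F}$ compatible with $\rho(\cdot;\alpha E)$. Moreover, if $C=\operatorname{cone}(x_{n_1},\dots,x_{n_d})\in\mathcal{F}$ is a maximal cone (with generators $x_{n_1},\dots,x_{n_d}\in E$), then for every $x=\sum_{k=1}^d c_k x_{n_k}$ with $c_k\ge 0$ one has $\rho(x;\alpha E)=\sum_{k=1}^d c_k\alpha_{n_k}$, where $\alpha_{n_k}$ denotes the weight attached to the direction $x_{n_k}$ (the direction $-x_i$ having the same weight $\alpha_i$ as $x_i$).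
   Context: A direction set in $(X,\|\cdot\|)$ is a finite subset $E\subset S_X$ of the unit sphere with $E=-E$ and $\operatorname{conv}(E)$ having nonempty interior; choosing one representative from each antipodal pair, write $E=\{\pm x_1,\dots,\pm x_n\}$ (cardinality $2n$), also regarded as the ordered list $(x_1,\dots,x_n,-x_1,\dots,-x_n)$. A multiindex is a vector $\alpha=(\alpha_1,\dots,\alpha_n)$ of real numbers, and $\alpha>0$ means all $\alpha_i>0$. For $\alpha>0$, $\operatorname{conv}(\alpha E)=\operatorname{conv}\{\pm\alpha_1^{-1}x_1,\dots,\pm\alpha_n^{-1}x_n\}$ and $\rho(x;\alpha E)=\inf\{r>0: x\in r\operatorname{conv}(\alpha E)\}$. The multiindex $\alpha>0$ is $E$-admissible if for every $i$ and every $0<\varepsilon_i<\alpha_i$, with $\alpha'=(\alpha_1,\dots,\alpha_i-\varepsilon_i,\dots,\alpha_n)$, one has $\rho(\cdot;\alpha'E)\ne\rho(\cdot;\alpha E)$. A polyhedral cone is a set $\operatorname{cone}(y_1,\dots,y_k)=\{\sum\lambda_i y_i:\lambda_i\ge0\}$. A fan $\mathcal{F}$ in $X$ is a finite collection of polyhedral cones, closed under taking faces, such that the intersection of any two of its cones is a face of both. It is simplicial if every cone is generated by a linearly independent set of vectors, complete if its cones cover $X$, and symmetric if $-C\in\mathcal{F}$ whenever $C\in\mathcal{F}$. It is an $E$-fan if every cone of $\mathcal{F}$ is generated by rays determined by elements of $E$. An $E$-fan $\mathcal{F}$ is compatible with $\rho(\cdot;\alpha E)$ if $\rho(\cdot;\alpha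 E)$ is linear on every $C\in\mathcal{F}$ (i.e. coincides on $C$ with a linear functional). *)

theory Defs
  imports "HOL-Analysis.Analysis"
begin

section \<open>Direction sets, multiindices and the functional rho\<close>

definition direction_set :: "'a::real_normed_vector set \<Rightarrow> bool" where
  "direction_set E \<longleftrightarrow>
     finite E \<and> E \<subseteq> sphere 0 1 \<and> uminus ` E = E \<and> interior (convex hull E) \<noteq> {}"

text \<open>
  The cardinality condition says that \<open>x 1, \<dots>, x n\<close> picks exactly one representative from each
  antipodal pair of \<open>E\<close>.
\<close>
definition direction_reps :: "'a::real_normed_vector set \<Rightarrow> nat \<Rightarrow> (nat \<Rightarrow> 'a) \<Rightarrow> bool" where
  "direction_reps E n x \<longleftrightarrow>
     E = (\<Union>i\<in>{1..n}. {x i, - x i}) \<and> card E = 2 * n"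

text \<open>
  The ordered list \<open>(x 1, \<dots>, x n, - x 1, \<dots>, - x n)\<close>, indexed by \<open>{1..2 * n}\<close>, and the weights
  attached to its entries.
\<close>
definition dir :: "nat \<Rightarrow> (nat \<Rightarrow> 'a::real_vector) \<Rightarrow> nat \<Rightarrow> 'a" where
  "dir n x j = (if j \<le> n then x j else - x (j - n))"

definition weight :: "nat \<Rightarrow> (nat \<Rightarrow> real) \<Rightarrow> nat \<Rightarrow> real" where
  "weight n \<alpha> j = (if j \<le> n then \<alpha> j else \<alpha> (j - n))"

definition conv_scaled :: "nat \<Rightarrow> (nat \<Rightarrow> 'a::real_vector) \<Rightarrow> (nat \<Rightarrow> real) \<Rightarrow> 'a set" where
  "conv_scaled n x \<alpha> =
     convex hull (\<Union>i\<in>{1..n}. {inverse (\<alpha> i) *\<^sub>R x i, - (inverse (\<alpha> i) *\<^sub>R x i)})"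

definition rho :: "nat \<Rightarrow> (nat \<Rightarrow> 'a::real_vector) \<Rightarrow> (nat \<Rightarrow> real) \<Rightarrow> 'a \<Rightarrow> real" where
  "rho n x \<alpha> v = Inf {r. r > 0 \<and> v \<in> (\<lambda>y. r *\<^sub>R y) ` conv_scaled n x \<alpha>}"

definition positive_multiindex :: "nat \<Rightarrow> (nat \<Rightarrow> real) \<Rightarrow> bool" where
  "positive_multiindex n \<alpha> \<longleftrightarrow> (\<forall>i\<in>{1..n}. \<alpha> i > 0)"

definition admissible :: "nat \<Rightarrow> (nat \<Rightarrow> 'a::real_vector) \<Rightarrow> (nat \<Rightarrow> real) \<Rightarrow> bool" where
  "admissible n x \<alpha> \<longleftrightarrow> positive_multiindex n \<alpha> \<and>
     (\<forall>i\<in>{1..n}. \<forall>\<epsilon>. 0 < \<epsilon> \<and> \<epsilon> < \<alpha> i \<longrightarrow> rho n x (\<alpha>(i := \<alpha> i - \<epsilon>)) \<noteq> rho n x \<alpha>)"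


section \<open>Polyhedral cones and fans\<close>

text \<open>
  Only meaningful for finite \<open>Y\<close>; \<open>poly_cone {} = {0}\<close>.
\<close>
definition poly_cone :: "'a::real_vector set \<Rightarrow> 'a set" where
  "poly_cone Y = {\<Sum>y\<in>Y. l y *\<^sub>R y | l. \<forall>y\<in>Y. (0::real) \<le> l y}"

definition polyhedral_cone :: "'a::real_vector set \<Rightarrow> bool" where
  "polyhedral_cone C \<longleftrightarrow> (\<exists>Y. finite Y \<and> C = poly_cone Y)"

text \<open>
  The library's \<open>face_of\<close> admits the empty set as a face of every set; the empty set is not a
  cone, so it is excluded here.
\<close>
definition cone_face :: "'a::real_vector set \<Rightarrow> 'a set \<Rightarrow> bool" where
  "cone_face G C \<longleftrightarrow> G face_of C \<and> G \<noteq> {}"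

definition fan :: "'a::real_vector set set \<Rightarrow> bool" where
  "fan \<F> \<longleftrightarrow>
     finite \<F> \<and>
     (\<forall>C\<in>\<F>. polyhedral_cone C) \<and>
     (\<forall>C\<in>\<F>. \<forall>G. cone_face G C \<longrightarrow> G \<in> \<F>) \<and>
     (\<forall>C\<in>\<F>. \<forall>D\<in>\<F>. cone_face (C \<inter> D) C \<and> cone_face (C \<inter> D) D)"

definition simplicial_fan :: "'a::real_vector set set \<Rightarrow> bool" where
  "simplicial_fan \<F> \<longleftrightarrow>
     fan \<F> \<and> (\<forall>C\<in>\<F>. \<exists>Y. finite Y \<and> independent Y \<and> C = poly_cone Y)"

definition complete_fan :: "'a::real_vector set set \<Rightarrow> bool" where
  "complete_fan \<F> \<longleftrightarrow> fan \<F> \<and> \<Union>\<F> = UNIV"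

definition symmetric_fan :: "'a::real_vector set set \<Rightarrow> bool" where
  "symmetric_fan \<F> \<longleftrightarrow> fan \<F> \<and> (\<forall>C\<in>\<F>. uminus ` C \<in> \<F>)"

definition E_fan :: "'a::real_vector set \<Rightarrow> 'a set set \<Rightarrow> bool" where
  "E_fan E \<F> \<longleftrightarrow> fan \<F> \<and> (\<forall>C\<in>\<F>. \<exists>Y. Y \<subseteq> E \<and> finite Y \<and> C = poly_cone Y)"

definition compatible :: "('a::real_vector \<Rightarrow> real) \<Rightarrow> 'a set set \<Rightarrow> bool" where
  "compatible p \<F> \<longleftrightarrow> (\<forall>C\<in>\<F>. \<exists>f. linear f \<and> (\<forall>v\<in>C. p v = f v))"

definition maximal_cone :: "'a set set \<Rightarrow> 'a set \<Rightarrow> bool" where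
  "maximal_cone \<F> C \<longleftrightarrow> C \<in> \<F> \<and> (\<forall>D\<in>\<F>. C \<subseteq> D \<longrightarrow> D = C)"

end

theory Submission
  imports Defs
begin

text \<open>
  Give \<open>e \<in> E\<close> the weight \<open>w e = \<rho> e\<close>. Admissibility says that no pair of generators
  \<open>\<plusminus> x i / \<alpha> i\<close> can be moved outwards without enlarging the unit ball of \<open>\<rho>\<close>, and this forces
  \<open>\<rho> (\<plusminus> x i) = \<alpha> i\<close> (\<open>admissible_rho_generator\<close>). Hence \<open>\<rho> v\<close> is the least cost
  \<open>\<Sum>e\<in>E. l e * w e\<close> of a nonnegative representation \<open>v = (\<Sum>e\<in>E. l e *\<^sub>R e)\<close>, and linear
  programming duality describes where it is linear: if a linear \<open>f\<close> satisfies \<open>f e \<le> w e\<close> on \<open>E\<close>,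
  then \<open>\<rho> = f\<close> on the cone over the contact set \<open>{e \<in> E. f e = w e}\<close> (\<open>rho_eq_functional\<close>). The
  formula on a cone with generators in \<open>E\<close> is then nothing but the linearity of \<open>\<rho>\<close> there, together
  with the values of \<open>\<rho>\<close> at the generators. It remains to cut the cones of contact into simplicial
  cones in a consistent and symmetric way, using generators in \<open>E\<close> only.

  This is the classical construction of a regular triangulation. Replace \<open>w\<close> by a nearby weight
  \<open>w'\<close>, still even, which is generic: every contact set of \<open>w'\<close> is linearly independent. The
  family \<open>contact_fan E w'\<close> of all cones generated by subsets of contact sets of vertices of the dual
  polytope \<open>{f. \<forall>e\<in>E. f e \<le> w' e}\<close> has the required properties. It is simplicial by genericity. It is
  symmetric because \<open>w'\<close> is even. It is a fan because a vector in two of its cones has all its optimal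
  representations supported in both contact sets (\<open>contact_cones_Int\<close>, by complementary slackness). It
  is complete by linear programming duality (\<open>weighted_cone_duality\<close>), which rests on a
  finite-dimensional Hahn-Banach theorem and on the existence of cheapest representations, followed by
  a push of the dual functional into a vertex (\<open>extend_to_dual_vertex\<close>).

  Compatibility with \<open>w\<close> comes from choosing \<open>w'\<close> close to \<open>w\<close>: only finitely many bases
  \<open>S \<subseteq> E\<close> occur, and a basis whose interpolating functional violates a constraint for \<open>w\<close>
  violates it for all small perturbations. So the contact set of a vertex for \<open>w'\<close> is contained in a
  contact set for \<open>w\<close> (\<open>generic_symmetric_weights\<close>). For \<open>w'\<close> one can take
  \<open>w e + t ^ k e\<close> with small \<open>t > 0\<close>, where the exponents \<open>k\<close> agree only on antipodal elements.
\<close>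


section \<open>A finite-dimensional Hahn-Banach theorem\<close>

definition sublinear :: "('a::real_vector \<Rightarrow> real) \<Rightarrow> bool" where
  "sublinear p \<longleftrightarrow>
     (\<forall>x y. p (x + y) \<le> p x + p y) \<and> (\<forall>c x. 0 \<le> c \<longrightarrow> p (c *\<^sub>R x) = c * p x)"

lemma sublinear_add: "sublinear p \<Longrightarrow> p (x + y) \<le> p x + p y"
  and sublinear_scale: "sublinear p \<Longrightarrow> 0 \<le> c \<Longrightarrow> p (c *\<^sub>R x) = c * p x"
  by (auto simp: sublinear_def)

lemma sublinear_zero: "sublinear p \<Longrightarrow> p 0 = 0"
  using sublinear_scale[of p 0 0] by simp

lemma sublinear_minus: "sublinear p \<Longrightarrow> - p (- x) \<le> p x"
  using sublinear_add[of p x "- x"] sublinear_zero[of p] by simp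

lemma sublinearI:
  assumes add: "\<And>x y. p (x + y) \<le> p x + p y"
    and zero: "p 0 = 0"
    and scale: "\<And>c x. 0 < c \<Longrightarrow> p (c *\<^sub>R x) \<le> c * p x"
  shows "sublinear p"
proof -
  have "p (c *\<^sub>R x) = c * p x" if "0 \<le> c" for c x
  proof (cases "c = 0")
    case False
    with that have c: "0 < c" by simp
    have "p (inverse c *\<^sub>R (c *\<^sub>R x)) \<le> inverse c * p (c *\<^sub>R x)"
      using c by (intro scale) simp
    then have "c * p x \<le> p (c *\<^sub>R x)"
      using c by (simp add: field_simps)
    with scale[OF c, of x] show ?thesis by simp
  qed (simp add: zero)
  with add show ?thesis by (auto simp: sublinear_def)
qed

text \<open>
  The largest sublinear functional below \<open>p\<close> whose value at \<open>- x\<close> is \<open>- p x\<close>; it is the infimum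
  of \<open>p (y + t *\<^sub>R x) - t * p x\<close> over \<open>t \<ge> 0\<close>. Passing to it makes \<open>p\<close> linear along the
  line through \<open>x\<close>.
\<close>
lemma sublinear_straighten:
  assumes p: "sublinear p"
  obtains q where "sublinear q" "\<And>y. q y \<le> p y" "q (- x) = - p x"
proof -
  define a where "a y t = p (y + t *\<^sub>R x) - t * p x" for y and t :: real
  define q where "q y = Inf (a y ` {0..})" for y
  have lower: "- p (- y) \<le> a y t" if "0 \<le> t" for y t
    using sublinear_add[OF p, of "- y" "y + t *\<^sub>R x"] sublinear_scale[OF p that, of x]
    by (simp add: a_def)
  have le: "q y \<le> a y t" if "0 \<le> t" for y t
    unfolding q_def using lower that by (intro cINF_lower bdd_belowI2) auto
  have ge: "z \<le> q y" if "\<And>t. 0 \<le> t \<Longrightarrow> z \<le> a y t" for y z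
    unfolding q_def using that by (intro cINF_greatest) auto
  have sub: "sublinear q"
  proof (rule sublinearI)
    fix y z
    have *: "q (y + z) \<le> a y s + a z t" if "0 \<le> s" "0 \<le> t" for s t
    proof -
      have "q (y + z) \<le> a (y + z) (s + t)" using that by (intro le) simp
      also have "\<dots> \<le> a y s + a z t"
        using sublinear_add[OF p, of "y + s *\<^sub>R x" "z + t *\<^sub>R x"]
        by (simp add: a_def algebra_simps)
      finally show ?thesis .
    qed
    have "q (y + z) - a y s \<le> q z" if "0 \<le> s" for s
      using *[OF that] by (intro ge) (simp add: algebra_simps)
    then have "q (y + z) - q z \<le> q y"
      by (intro ge) (simp add: algebra_simps)
    then show "q (y + z) \<le> q y + q z" by simp
  next
    have "a 0 t = 0" if "0 \<le> t" for t
      using sublinear_scale[OF p that] by (simp add: a_def)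
    then show "q 0 = 0" using le[of 0 0] ge[of 0 0] by simp
  next
    fix c :: real and y assume c: "0 < c"
    have "q (c *\<^sub>R y) / c \<le> a y t" if "0 \<le> t" for t
    proof -
      have "q (c *\<^sub>R y) \<le> a (c *\<^sub>R y) (c * t)" using c that by (intro le) simp
      also have "\<dots> = c * a y t"
        using sublinear_scale[OF p, of c "y + t *\<^sub>R x"] c by (simp add: a_def algebra_simps)
      finally show ?thesis using c by (simp add: field_simps)
    qed
    then have "q (c *\<^sub>R y) / c \<le> q y" by (rule ge)
    then show "q (c *\<^sub>R y) \<le> c * q y" using c by (simp add: field_simps)
  qed
  have below: "q y \<le> p y" for y using le[of 0 y] by (simp add: a_def)
  have "q (- x) \<le> - p x"
    using le[of 1 "- x"] sublinear_zero[OF p] by (simp add: a_def)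
  moreover have "- p x \<le> q (- x)"
    using sublinear_minus[OF sub, of x] below[of x] by simp
  ultimately show thesis using that sub below by force
qed

text \<open>
  Straightening is applied to one element of \<open>B\<close> after the other. Oddness at earlier elements is not
  lost: a sublinear \<open>q\<close> below \<open>r\<close> satisfies \<open>- q (- b) \<le> q b \<le> r b\<close> and
  \<open>q (- b) \<le> r (- b) = - r b\<close>, so it agrees with \<open>r\<close> at \<open>\<plusminus> b\<close>.
\<close>
lemma sublinear_odd_on_finite:
  assumes "finite B" "sublinear p"
  shows "\<exists>q. sublinear q \<and> (\<forall>y. q y \<le> p y) \<and> (\<forall>b\<in>B. q (- b) = - q b)"
  using assms(1)
proof induction
  case empty
  then show ?case using assms(2) by auto
next
  case (insert x B)
  then obtain r where r: "sublinear r" "\<And>y. r y \<le> p y" "\<And>b. b \<in> B \<Longrightarrow> r (- b) = - r b"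
    by blast
  obtain q where q: "sublinear q" "\<And>y. q y \<le> r y" "q (- x) = - r x"
    using sublinear_straighten[OF r(1)] by blast
  have "q (- b) = - q b" if "r (- b) = - r b \<or> b = x" for b
    using sublinear_minus[OF q(1), of b] q(2)[of b] q(2)[of "- b"] q(3) that by auto
  moreover have "q y \<le> p y" for y
    using q(2)[of y] r(2)[of y] by simp
  ultimately show ?case using q(1) r(3) by blast
qed

text \<open>
  The vectors at which a sublinear functional is odd form a subspace, and oddness turns subadditivity
  into additivity.
\<close>
lemma sublinear_odd_imp_linear:
  assumes q: "sublinear q" and B: "span B = UNIV" and odd: "\<And>b. b \<in> B \<Longrightarrow> q (- b) = - q b"
  shows "linear q"
proof -
  have "subspace {y. q (- y) = - q y}"
  proof (rule subspaceI)
    fix y z assume yz: "y \<in> {y. q (- y) = - q y}" "z \<in> {y. q (- y) = - q y}"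
    then show "y + z \<in> {y. q (- y) = - q y}"
      using sublinear_add[OF q, of y z] sublinear_add[OF q, of "- y" "- z"]
        sublinear_minus[OF q, of "y + z"] by simp
  next
    fix c y assume y: "y \<in> {y. q (- y) = - q y}"
    show "c *\<^sub>R y \<in> {y. q (- y) = - q y}"
    proof (cases "0 \<le> c")
      case True
      then show ?thesis
        using sublinear_scale[OF q True, of y] sublinear_scale[OF q True, of "- y"] y by simp
    next
      case False
      then have "0 \<le> - c" by simp
      from sublinear_scale[OF q this, of y] sublinear_scale[OF q this, of "- y"] y
      show ?thesis by simp
    qed
  qed (simp add: sublinear_zero[OF q])
  with B odd have odd': "q (- y) = - q y" for y
    using span_minimal[of B "{y. q (- y) = - q y}"] by auto
  show ?thesis
  proof (rule linearI)
    fix y z show "q (y + z) = q y + q z"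
      using sublinear_add[OF q, of y z] sublinear_add[OF q, of "- y" "- z"] odd'[of y] odd'[of z]
        odd'[of "y + z"] by simp
  next
    fix c y show "q (c *\<^sub>R y) = c *\<^sub>R q y"
    proof (cases "0 \<le> c")
      case True
      then show ?thesis by (simp add: sublinear_scale[OF q])
    next
      case False
      then show ?thesis
        using sublinear_scale[OF q, of "- c" y] odd'[of "c *\<^sub>R y"] by simp
    qed
  qed
qed

text \<open>
  Hahn-Banach in finite dimension. Straightening along \<open>v\<close> first pins the value at \<open>v\<close>, because
  every smaller linear functional must respect the bound \<open>- p v\<close> at \<open>- v\<close>.
\<close>
lemma supporting_functional:
 fixes p :: "'a::real_vector \<Rightarrow> real" and B :: "'a set"
  assumes "finite B" "span B = UNIV" "sublinear p"
  obtains f where "linear f" "\<And>y. f y \<le> p y" "f v = p v"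
proof -
  obtain r where r: "sublinear r" "\<And>y. r y \<le> p y" "r (- v) = - p v"
    using sublinear_straighten[OF assms(3)] by blast
  obtain q where q: "sublinear q" "\<And>y. q y \<le> r y" "\<And>b. b \<in> B \<Longrightarrow> q (- b) = - q b"
    using sublinear_odd_on_finite[OF assms(1) r(1)] by blast
  have "linear q" using sublinear_odd_imp_linear[OF q(1) assms(2) q(3)] .
  moreover have "q y \<le> p y" for y using q(2)[of y] r(2)[of y] by simp
  moreover have "p v \<le> q v"
    using q(2)[of "- v"] r(3) linear_neg[OF \<open>linear q\<close>, of v] by simp
  ultimately show thesis using that[of q] by (simp add: order_antisym)
qed


section \<open>Polyhedral cones and their faces\<close>

text \<open>
  Cones over different subsets of \<open>Y\<close> become comparable when their coefficients are all indexed by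
  \<open>Y\<close>.
\<close>
lemma poly_cone_support_iff:
  assumes "finite Y" "Z \<subseteq> Y"
  shows "v \<in> poly_cone Z \<longleftrightarrow>
    (\<exists>l. (\<forall>y\<in>Y. 0 \<le> l y) \<and> (\<forall>y\<in>Y - Z. l y = 0) \<and> v = (\<Sum>y\<in>Y. l y *\<^sub>R y))"
proof
  assume "v \<in> poly_cone Z"
  then obtain l where l: "\<And>z. z \<in> Z \<Longrightarrow> 0 \<le> l z" "v = (\<Sum>z\<in>Z. l z *\<^sub>R z)"
    by (auto simp: poly_cone_def)
  have "v = (\<Sum>y\<in>Y. (if y \<in> Z then l y else 0) *\<^sub>R y)"
    unfolding l(2) using assms by (intro sum.mono_neutral_cong_left) auto
  with l(1) show "\<exists>l. (\<forall>y\<in>Y. 0 \<le> l y) \<and> (\<forall>y\<in>Y - Z. l y = 0) \<and> v = (\<Sum>y\<in>Y. l y *\<^sub>R y)"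
    by (intro exI[of _ "\<lambda>y. if y \<in> Z then l y else 0"]) auto
next
  assume "\<exists>l. (\<forall>y\<in>Y. 0 \<le> l y) \<and> (\<forall>y\<in>Y - Z. l y = 0) \<and> v = (\<Sum>y\<in>Y. l y *\<^sub>R y)"
  then obtain l where l: "\<forall>y\<in>Y. 0 \<le> l y" "\<forall>y\<in>Y - Z. l y = 0" "v = (\<Sum>y\<in>Y. l y *\<^sub>R y)"
    by blast
  have "v = (\<Sum>z\<in>Z. l z *\<^sub>R z)"
    unfolding l(3) using assms l(2) by (intro sum.mono_neutral_right) auto
  with l(1) assms(2) show "v \<in> poly_cone Z" by (auto simp: poly_cone_def)
qed

lemma poly_cone_mono:
  assumes "finite Y" "Z \<subseteq> Y"
  shows "poly_cone Z \<subseteq> poly_cone Y"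
  using poly_cone_support_iff[OF assms] poly_cone_support_iff[OF assms(1) order_refl]
  by blast

lemma poly_cone_base:
  assumes "finite Y" "y \<in> Y"
  shows "y \<in> poly_cone Y"
proof -
  have "{y} \<subseteq> Y" using assms by simp
  moreover have "y \<in> poly_cone {y}"
    unfolding poly_cone_def by (auto intro!: exI[of _ "\<lambda>_. 1::real"])
  ultimately show ?thesis using poly_cone_mono[OF assms(1)] by blast
qed

lemma span_UNIV_if_cone: "poly_cone E = UNIV \<Longrightarrow> span E = UNIV"
proof -
  have "poly_cone E \<subseteq> span E"
    unfolding poly_cone_def by (auto intro: span_sum span_scale span_base)
  then show "poly_cone E = UNIV \<Longrightarrow> span E = UNIV" by auto
qed

lemma poly_cone_nonneg_comb:
  assumes "a \<in> poly_cone Y" "b \<in> poly_cone Y" "0 \<le> s" "0 \<le> t"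
  shows "s *\<^sub>R a + t *\<^sub>R b \<in> poly_cone Y"
proof -
  obtain l m where lm: "\<forall>y\<in>Y. 0 \<le> l y" "a = (\<Sum>y\<in>Y. l y *\<^sub>R y)"
      "\<forall>y\<in>Y. 0 \<le> m y" "b = (\<Sum>y\<in>Y. m y *\<^sub>R y)"
    using assms(1,2) by (auto simp: poly_cone_def)
  then have "s *\<^sub>R a + t *\<^sub>R b = (\<Sum>y\<in>Y. (s * l y + t * m y) *\<^sub>R y)"
    by (simp add: scaleR_sum_right sum.distrib scaleR_add_left)
  with lm assms(3,4) show ?thesis by (force simp: poly_cone_def)
qed

lemma convex_poly_cone: "convex (poly_cone Y)"
  by (simp add: convex_def poly_cone_nonneg_comb)

lemma zero_in_poly_cone: "0 \<in> poly_cone Y"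
  unfolding poly_cone_def by (auto intro!: exI[of _ "\<lambda>_. 0::real"])

lemma scale_in_poly_cone: "a \<in> poly_cone Y \<Longrightarrow> 0 \<le> s \<Longrightarrow> s *\<^sub>R a \<in> poly_cone Y"
  using poly_cone_nonneg_comb[of a Y a s 0] by simp

lemma poly_cone_sum:
  assumes "finite I" "\<And>i. i \<in> I \<Longrightarrow> 0 \<le> c i" "\<And>i. i \<in> I \<Longrightarrow> a i \<in> poly_cone Y"
  shows "(\<Sum>i\<in>I. c i *\<^sub>R a i) \<in> poly_cone Y"
  using assms
proof induction
  case (insert i I)
  then show ?case
    using poly_cone_nonneg_comb[of "a i" Y "\<Sum>i\<in>I. c i *\<^sub>R a i" "c i" 1] by simp
qed (simp add: zero_in_poly_cone)

lemma uminus_poly_cone: "uminus ` poly_cone Y = poly_cone (uminus ` Y)"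
proof -
  have sub: "uminus ` poly_cone Y \<subseteq> poly_cone (uminus ` Y)" for Y :: "'a set"
  proof (clarsimp simp: poly_cone_def)
    fix l :: "'a \<Rightarrow> real" assume l: "\<forall>y\<in>Y. 0 \<le> l y"
    have "- (\<Sum>y\<in>Y. l y *\<^sub>R y) = (\<Sum>y\<in>uminus ` Y. l (- y) *\<^sub>R y)"
      by (subst sum.reindex) (auto simp: sum_negf)
    with l show "\<exists>m. - (\<Sum>y\<in>Y. l y *\<^sub>R y) = (\<Sum>y\<in>uminus ` Y. m y *\<^sub>R y) \<and> (\<forall>x\<in>Y. 0 \<le> m (- x))"
      by (intro exI[of _ "\<lambda>y. l (- y)"]) auto
  qed
  have "uminus ` uminus ` poly_cone (uminus ` Y) \<subseteq> uminus ` poly_cone (uminus ` uminus ` Y)"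
    by (intro image_mono sub)
  with sub[of Y] show ?thesis by (simp add: image_image)
qed

lemma independent_coeffs_unique:
  assumes "finite Y" "independent Y" "(\<Sum>y\<in>Y. l y *\<^sub>R y) = (\<Sum>y\<in>Y. m y *\<^sub>R y)" "y \<in> Y"
  shows "l y = m y"
proof -
  have "(\<Sum>y\<in>Y. (l y - m y) *\<^sub>R y) = 0"
    using assms(3) by (simp add: scaleR_diff_left sum_subtractf)
  from independentD[OF assms(2,1) order_refl this assms(4)] show ?thesis by simp
qed

text \<open>
  If a positive combination of two points of the cone has vanishing coefficients outside \<open>Z\<close>, then,
  coefficients being unique and nonnegative, so have both points.
\<close>
lemma sub_cone_face:
  assumes fin: "finite Y" and ind: "independent Y" and ZY: "Z \<subseteq> Y"
  shows "cone_face (poly_cone Z) (poly_cone Y)"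
proof -
  have key: "a \<in> poly_cone Z"
    if a: "a \<in> poly_cone Y" and b: "b \<in> poly_cone Y" and st: "0 < s" "0 < t"
      and ab: "s *\<^sub>R a + t *\<^sub>R b \<in> poly_cone Z" for a b s t
  proof -
    obtain l where l: "\<forall>y\<in>Y. 0 \<le> l y" "a = (\<Sum>y\<in>Y. l y *\<^sub>R y)"
      using a by (auto simp: poly_cone_def)
    obtain m where m: "\<forall>y\<in>Y. 0 \<le> m y" "b = (\<Sum>y\<in>Y. m y *\<^sub>R y)"
      using b by (auto simp: poly_cone_def)
    obtain k where k: "\<forall>y\<in>Y - Z. k y = 0" "s *\<^sub>R a + t *\<^sub>R b = (\<Sum>y\<in>Y. k y *\<^sub>R y)"
      using ab[unfolded poly_cone_support_iff[OF fin ZY]] by blast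
    have "(\<Sum>y\<in>Y. (s * l y + t * m y) *\<^sub>R y) = (\<Sum>y\<in>Y. k y *\<^sub>R y)"
      using k(2) l(2) m(2) by (simp add: scaleR_sum_right sum.distrib scaleR_add_left)
    then have eq: "s * l y + t * m y = k y" if "y \<in> Y" for y
      using independent_coeffs_unique[OF fin ind, where l = "\<lambda>y. s * l y + t * m y" and m = k]
        that by blast
    have "l y = 0" if "y \<in> Y - Z" for y
    proof -
      have "s * l y + t * m y = 0" "0 \<le> s * l y" "0 \<le> t * m y"
        using eq[of y] k(1) l(1) m(1) st that by auto
      then have "s * l y = 0" by linarith
      then show ?thesis using st by simp
    qed
    with l show ?thesis unfolding poly_cone_support_iff[OF fin ZY] by blast
  qed
  have "poly_cone Z face_of poly_cone Y"
    unfolding face_of_def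
  proof (intro conjI ballI impI)
    show "poly_cone Z \<subseteq> poly_cone Y" by (rule poly_cone_mono[OF fin ZY])
    show "convex (poly_cone Z)" by (rule convex_poly_cone)
    fix a b v
    assume *: "a \<in> poly_cone Y" "b \<in> poly_cone Y" "v \<in> poly_cone Z" "v \<in> open_segment a b"
    then obtain u where u: "0 < u" "u < 1" "v = (1 - u) *\<^sub>R a + u *\<^sub>R b"
      by (auto simp: in_segment)
    show "a \<in> poly_cone Z" using key[of a b "1 - u" u] * u by simp
    show "b \<in> poly_cone Z" using key[of b a u "1 - u"] * u by (simp add: add.commute)
  qed
  then show ?thesis using zero_in_poly_cone[of Z] by (auto simp: cone_face_def)
qed

text \<open>
  A face of a cone is closed under sums and nonnegative multiples, and contains the summands of its
  elements, as far as these lie in the cone. So it contains each generator that occurs with a positive coefficient in one of its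
  elements.
\<close>
lemma face_of_poly_cone_generated:
  assumes fin: "finite Y" and G: "cone_face G (poly_cone Y)"
  shows "G = poly_cone (Y \<inter> G)"
proof -
  have sub: "G \<subseteq> poly_cone Y" and conv: "convex G" and ne: "G \<noteq> {}"
    and face: "\<And>a b v. a \<in> poly_cone Y \<Longrightarrow> b \<in> poly_cone Y \<Longrightarrow> v \<in> G \<Longrightarrow>
      v \<in> open_segment a b \<Longrightarrow> a \<in> G \<and> b \<in> G"
    using G unfolding cone_face_def face_of_def by blast+
  have summand: "a \<in> G"
    if "a \<in> poly_cone Y" "b \<in> poly_cone Y" "0 < u" "u < 1" "(1 - u) *\<^sub>R a + u *\<^sub>R b \<in> G" for a b u
  proof (cases "a = b")
    case True
    with that show ?thesis by (simp add: algebra_simps)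
  next
    case False
    then have "(1 - u) *\<^sub>R a + u *\<^sub>R b \<in> open_segment a b"
      using that by (auto simp: in_segment)
    with face that show ?thesis by blast
  qed
  \<comment> \<open>Rays lie in the face as soon as one of their nonzero points does: \<open>g\<close> lies between
      \<open>0\<close> and \<open>c *\<^sub>R g\<close> for \<open>c > 1\<close>.\<close>
  obtain g0 where g0: "g0 \<in> G" using ne by blast
  have zero: "0 \<in> G"
    using summand[of 0 "2 *\<^sub>R g0" "1/2"] g0 sub zero_in_poly_cone scale_in_poly_cone[of g0 Y 2]
    by auto
  have scale: "c *\<^sub>R g \<in> G" if "g \<in> G" "0 \<le> c" for c g
  proof (cases "c \<le> 1")
    case True
    then show ?thesis
      using convexD[OF conv that(1) zero, of c "1 - c"] that by simp
  next
    case False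
    then have "(1 - (1 - 1/c)) *\<^sub>R (c *\<^sub>R g) + (1 - 1/c) *\<^sub>R 0 = g" by simp
    then show ?thesis
      using summand[of "c *\<^sub>R g" 0 "1 - 1/c"] that False sub zero_in_poly_cone
        scale_in_poly_cone[of g Y c] by (auto simp: field_simps)
  qed
  have add: "g + h \<in> G" if "g \<in> G" "h \<in> G" for g h
  proof -
    have "(1/2) *\<^sub>R g + (1/2) *\<^sub>R h \<in> G" by (rule convexD[OF conv that]) auto
    from scale[OF this, of 2] show ?thesis by (simp add: scaleR_add_right)
  qed
  have "g \<in> poly_cone (Y \<inter> G)" if "g \<in> G" for g
  proof -
    obtain l where l: "\<forall>y\<in>Y. 0 \<le> l y" "g = (\<Sum>y\<in>Y. l y *\<^sub>R y)"
      using subsetD[OF sub \<open>g \<in> G\<close>] unfolding poly_cone_def by blast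
    have "l y = 0" if y: "y \<in> Y - G" for y
    proof (rule ccontr)
      assume "l y \<noteq> 0"
      with l y have pos: "0 < l y" by force
      let ?r = "\<Sum>z\<in>Y - {y}. l z *\<^sub>R z"
      have "?r \<in> poly_cone (Y - {y})" using l(1) by (auto simp: poly_cone_def)
      then have "?r \<in> poly_cone Y" by (rule subsetD[OF poly_cone_mono[OF fin Diff_subset]])
      then have r: "2 *\<^sub>R ?r \<in> poly_cone Y" by (rule scale_in_poly_cone) simp
      have "g = l y *\<^sub>R y + ?r" unfolding l(2) using fin y by (intro sum.remove) auto
      \<comment> \<open>The midpoint of twice the two summands is \<open>g\<close> itself.\<close>
      then have "(1 - 1/2) *\<^sub>R (2 *\<^sub>R (l y *\<^sub>R y)) + (1/2) *\<^sub>R (2 *\<^sub>R ?r) = g"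
        by (simp only: scaleR_scaleR) simp
      moreover have "2 *\<^sub>R (l y *\<^sub>R y) \<in> poly_cone Y"
        using scale_in_poly_cone[of y Y "2 * l y"] poly_cone_base[OF fin, of y] y pos by simp
      ultimately have "2 *\<^sub>R (l y *\<^sub>R y) \<in> G"
        using summand[OF _ r, of "2 *\<^sub>R (l y *\<^sub>R y)" "1/2"] \<open>g \<in> G\<close> by simp
      from scale[OF this, of "1 / (2 * l y)"] have "y \<in> G" using pos by simp
      with y show False by simp
    qed
    then have "\<forall>y\<in>Y - (Y \<inter> G). l y = 0" by blast
    with l show ?thesis
      by (intro poly_cone_support_iff[OF fin, THEN iffD2] exI[of _ l]) auto
  qed
  moreover have "g \<in> G" if g: "g \<in> poly_cone (Y \<inter> G)" for g
  proof -
    obtain l where l: "\<forall>y\<in>Y \<inter> G. 0 \<le> l y" "g = (\<Sum>y\<in>Y \<inter> G. l y *\<^sub>R y)"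
      using g by (auto simp: poly_cone_def)
    have "(\<Sum>y\<in>A. l y *\<^sub>R y) \<in> G" if "finite A" "A \<subseteq> Y \<inter> G" for A
      using that
    proof induction
      case (insert y A)
      then have "l y *\<^sub>R y \<in> G" by (intro scale bspec[OF l(1)]) auto
      with insert show ?case by (simp add: add)
    qed (simp add: zero)
    with l(2) fin show ?thesis by simp
  qed
  ultimately show ?thesis by blast
qed


section \<open>Linear programming duality for weighted generators\<close>

definition contact_set :: "'a set \<Rightarrow> ('a \<Rightarrow> real) \<Rightarrow> ('a \<Rightarrow> real) \<Rightarrow> 'a set" where
  "contact_set E w f = {e\<in>E. f e = w e}"

lemma finite_minimizer:
  fixes f :: "'a \<Rightarrow> real"
  assumes "finite A" "A \<noteq> {}"
  obtains a where "a \<in> A" "\<And>b. b \<in> A \<Longrightarrow> f a \<le> f b"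
  using arg_min_if_finite(1)[OF assms, of f] arg_min_least[OF assms, of _ f] by blast

text \<open>
  Caratheodory's reduction with costs. A multiple of a linear relation among the generators in use is subtracted
  from the coefficients until one of them vanishes; the sign of the relation is chosen so that the cost
  does not grow.
\<close>
lemma independent_support_no_dearer:
  fixes E :: "'a::real_vector set" and w l :: "'a \<Rightarrow> real"
  assumes fin: "finite E" and w: "\<And>e. e \<in> E \<Longrightarrow> 0 < w e" and l: "\<And>e. e \<in> E \<Longrightarrow> 0 \<le> l e"
  shows "\<exists>m. (\<forall>e\<in>E. 0 \<le> m e) \<and> (\<Sum>e\<in>E. m e *\<^sub>R e) = (\<Sum>e\<in>E. l e *\<^sub>R e) \<and>
    (\<Sum>e\<in>E. m e * w e) \<le> (\<Sum>e\<in>E. l e * w e) \<and> independent {e\<in>E. m e \<noteq> 0}"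
  using l
proof (induction "card {e\<in>E. l e \<noteq> 0}" arbitrary: l rule: less_induct)
  case less
  let ?S = "{e\<in>E. l e \<noteq> 0}"
  show ?case
  proof (cases "independent ?S")
    case True
    with less.prems show ?thesis by (intro exI[of _ l]) simp
  next
    case False
    then obtain u where u: "\<exists>e\<in>?S. u e \<noteq> 0" "(\<Sum>e\<in>?S. u e *\<^sub>R e) = 0"
      using dependent_finite[of ?S] fin by auto
    define \<sigma> :: real where "\<sigma> = (if 0 \<le> (\<Sum>e\<in>?S. u e * w e) then 1 else - 1)"
    define \<mu> where "\<mu> e = (if e \<in> ?S then \<sigma> * u e else 0)" for e
    have \<sigma>: "\<sigma> \<noteq> 0" by (simp add: \<sigma>_def)
    have "(\<Sum>e\<in>E. \<mu> e *\<^sub>R e) = (\<Sum>e\<in>?S. \<sigma> *\<^sub>R (u e *\<^sub>R e))"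
      using fin by (intro sum.mono_neutral_cong_right) (auto simp: \<mu>_def)
    also have "\<dots> = 0" using u(2) by (simp only: flip: scaleR_sum_right) simp
    finally have rel: "(\<Sum>e\<in>E. \<mu> e *\<^sub>R e) = 0" .
    have "(\<Sum>e\<in>E. \<mu> e * w e) = (\<Sum>e\<in>?S. \<sigma> * (u e * w e))"
      using fin by (intro sum.mono_neutral_cong_right) (auto simp: \<mu>_def)
    also have "\<dots> = \<sigma> * (\<Sum>e\<in>?S. u e * w e)" by (simp only: sum_distrib_left)
    also have "\<dots> \<ge> 0" by (simp add: \<sigma>_def)
    finally have gain: "0 \<le> (\<Sum>e\<in>E. \<mu> e * w e)" .
    \<comment> \<open>The relation must have a positive coefficient: otherwise, all weights being positive,
        it would have a negative cost.\<close>
    have "\<exists>e\<in>E. 0 < \<mu> e"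
    proof (rule ccontr)
      assume "\<not> ?thesis"
      then have neg: "\<mu> e \<le> 0" if "e \<in> E" for e using that by force
      obtain a where a: "a \<in> ?S" "u a \<noteq> 0" using u(1) by blast
      with \<sigma> neg[of a] have "\<mu> a < 0" by (auto simp: \<mu>_def less_le)
      then have "(\<Sum>e\<in>E. \<mu> e * w e) < (\<Sum>e\<in>E. 0)"
        using fin a neg w by (intro sum_strict_mono_ex1)
          (auto intro!: bexI[of _ a] mult_nonpos_nonneg mult_neg_pos simp: less_imp_le)
      with gain show False by simp
    qed
    then have ne: "finite {e\<in>E. 0 < \<mu> e}" "{e\<in>E. 0 < \<mu> e} \<noteq> {}" using fin by auto
    obtain a where a: "a \<in> E" "0 < \<mu> a"
      and min: "\<And>e. e \<in> E \<Longrightarrow> 0 < \<mu> e \<Longrightarrow> l a / \<mu> a \<le> l e / \<mu> e"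
      by (rule finite_minimizer[OF ne, of "\<lambda>e. l e / \<mu> e"]) auto
    define s where "s = l a / \<mu> a"
    have s: "0 \<le> s" using less.prems[of a] a by (simp add: s_def)
    define m where "m e = l e - s * \<mu> e" for e
    have nonneg: "0 \<le> m e" if "e \<in> E" for e
    proof (cases "0 < \<mu> e")
      case True
      with min[OF that] show ?thesis by (simp add: m_def s_def field_simps)
    next
      case False
      then have "s * \<mu> e \<le> 0" using s by (simp add: mult_nonneg_nonpos)
      with less.prems[OF that] show ?thesis by (simp add: m_def)
    qed
    have "a \<in> ?S" using a by (auto simp: \<mu>_def split: if_splits)
    moreover have "m a = 0" using a by (simp add: m_def s_def)
    moreover have "m e = 0" if "l e = 0" for e using that by (simp add: m_def \<mu>_def)
    ultimately have "{e\<in>E. m e \<noteq> 0} \<subset> ?S" by auto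
    then have card: "card {e\<in>E. m e \<noteq> 0} < card ?S" using fin by (intro psubset_card_mono) auto
    have vec: "(\<Sum>e\<in>E. m e *\<^sub>R e) = (\<Sum>e\<in>E. l e *\<^sub>R e)"
    proof -
      have "(\<Sum>e\<in>E. m e *\<^sub>R e) = (\<Sum>e\<in>E. l e *\<^sub>R e) - s *\<^sub>R (\<Sum>e\<in>E. \<mu> e *\<^sub>R e)"
        by (simp add: m_def scaleR_diff_left sum_subtractf scaleR_sum_right)
      with rel show ?thesis by simp
    qed
    have cost: "(\<Sum>e\<in>E. m e * w e) \<le> (\<Sum>e\<in>E. l e * w e)"
    proof -
      have "(\<Sum>e\<in>E. m e * w e) = (\<Sum>e\<in>E. l e * w e) - s * (\<Sum>e\<in>E. \<mu> e * w e)"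
        by (simp add: m_def left_diff_distrib sum_subtractf sum_distrib_left mult.assoc)
      with gain s show ?thesis by simp
    qed
    from less.hyps[OF card nonneg] vec cost show ?thesis by fastforce
  qed
qed

text \<open>
  By the previous lemma only representations with independent support compete for the least cost.
  Each independent support admits at most one representation, so finitely many costs remain.
\<close>
lemma optimal_representation:
  fixes E :: "'a::real_vector set" and w :: "'a \<Rightarrow> real"
  assumes fin: "finite E" and w: "\<And>e. e \<in> E \<Longrightarrow> 0 < w e" and v: "v \<in> poly_cone E"
  shows "\<exists>l. (\<forall>e\<in>E. 0 \<le> l e) \<and> (\<Sum>e\<in>E. l e *\<^sub>R e) = v \<and>
    (\<forall>m. (\<forall>e\<in>E. 0 \<le> m e) \<and> (\<Sum>e\<in>E. m e *\<^sub>R e) = v \<longrightarrow>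
      (\<Sum>e\<in>E. l e * w e) \<le> (\<Sum>e\<in>E. m e * w e))"
proof -
  define rep where "rep l \<longleftrightarrow> (\<forall>e\<in>E. 0 \<le> l e) \<and> (\<Sum>e\<in>E. l e *\<^sub>R e) = v" for l :: "'a \<Rightarrow> real"
  define cost where "cost l = (\<Sum>e\<in>E. l e * w e)" for l
  define K where "K = {cost l | l. rep l \<and> independent {e\<in>E. l e \<noteq> 0}}"
  have "K \<subseteq> (\<lambda>S. \<Sum>e\<in>E. representation S v e * w e) ` Pow E"
  proof
    fix c assume "c \<in> K"
    then obtain l where l: "rep l" "independent {e\<in>E. l e \<noteq> 0}" "c = cost l"
      by (auto simp: K_def)
    define l' where "l' e = (if e \<in> E then l e else 0)" for e
    let ?S = "{e\<in>E. l e \<noteq> 0}"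
    have S: "{e. l' e \<noteq> 0} = ?S" by (auto simp: l'_def)
    have sum: "(\<Sum>e\<in>?S. l' e *\<^sub>R e) = v"
      using l(1) fin unfolding rep_def
      by (auto simp: l'_def intro!: sum.mono_neutral_cong_left)
    then have "v \<in> span ?S" by (auto intro: span_sum span_scale span_base)
    then have "representation ?S v = l'"
      by (rule representation_eqI[OF l(2)]) (use S fin sum in auto)
    then have "c = (\<Sum>e\<in>E. representation ?S v e * w e)"
      by (simp add: l(3) cost_def l'_def)
    then show "c \<in> (\<lambda>S. \<Sum>e\<in>E. representation S v e * w e) ` Pow E" by blast
  qed
  then have finK: "finite K" using fin by (meson finite_Pow_iff finite_imageI finite_subset)
  have below: "\<exists>c\<in>K. c \<le> cost m" if "rep m" for m
    using independent_support_no_dearer[OF fin, of w m] w that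
    unfolding rep_def K_def cost_def by fastforce
  from v obtain m where "rep m" by (auto simp: poly_cone_def rep_def)
  with below have "K \<noteq> {}" by blast
  with finK have "Min K \<in> K" by (rule Min_in)
  then obtain l where l: "rep l" "cost l = Min K" by (auto simp: K_def)
  have "cost l \<le> cost m" if "rep m" for m
    using below[OF that] Min_le[OF finK] l(2) by fastforce
  with l(1) show ?thesis unfolding rep_def cost_def by blast
qed

text \<open>
  The hypothesis on \<open>l\<close> says that its cost is as small as the value of the dual functional allows.
  The sum of the nonnegative terms \<open>l e * (w e - f e)\<close> is then zero.
\<close>
lemma complementary_slackness:
  assumes fin: "finite E" and f: "linear f" "\<And>e. e \<in> E \<Longrightarrow> f e \<le> w e"
    and l: "\<And>e. e \<in> E \<Longrightarrow> 0 \<le> l e" "(\<Sum>e\<in>E. l e * w e) \<le> f (\<Sum>e\<in>E. l e *\<^sub>R e)"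
    and e: "e \<in> E - contact_set E w f"
  shows "l e = (0::real)"
proof -
  have nonneg: "\<forall>e\<in>E. 0 \<le> l e * (w e - f e)" using f(2) l(1) by simp
  have "(\<Sum>e\<in>E. l e * (w e - f e)) = (\<Sum>e\<in>E. l e * w e) - f (\<Sum>e\<in>E. l e *\<^sub>R e)"
    by (simp add: linear_sum[OF f(1)] linear_cmul[OF f(1)] right_diff_distrib sum_subtractf)
  with l(2) have "(\<Sum>e\<in>E. l e * (w e - f e)) \<le> 0" by simp
  with nonneg have "(\<Sum>e\<in>E. l e * (w e - f e)) = 0" by (simp add: sum_nonneg order_antisym)
  with nonneg fin e have "l e * (w e - f e) = 0" by (simp add: sum_nonneg_eq_0_iff)
  with e show ?thesis by (auto simp: contact_set_def)
qed

text \<open>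
  The least cost of a representation of \<open>u\<close> is a sublinear function of \<open>u\<close>. A linear functional
  below it that agrees with it at \<open>v\<close> is dual to a cheapest representation of \<open>v\<close>, which by
  complementary slackness uses contact elements only.
\<close>
lemma weighted_cone_duality:
  fixes E :: "'a::real_vector set" and w :: "'a \<Rightarrow> real"
  assumes fin: "finite E" and w: "\<And>e. e \<in> E \<Longrightarrow> 0 < w e" and cone: "poly_cone E = UNIV"
  obtains f where "linear f" "\<And>e. e \<in> E \<Longrightarrow> f e \<le> w e" "v \<in> poly_cone (contact_set E w f)"
proof -
  define rep where "rep l u \<longleftrightarrow> (\<forall>e\<in>E. 0 \<le> l e) \<and> (\<Sum>e\<in>E. l e *\<^sub>R e) = u"
    for l :: "'a \<Rightarrow> real" and u
  define cost where "cost l = (\<Sum>e\<in>E. l e * w e)" for l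
  have "\<exists>l. rep l u \<and> (\<forall>m. rep m u \<longrightarrow> cost l \<le> cost m)" for u
    unfolding rep_def cost_def conj_assoc by (rule optimal_representation) (use fin w cone in auto)
  then have "\<forall>u. \<exists>l. rep l u \<and> (\<forall>m. rep m u \<longrightarrow> cost l \<le> cost m)" ..
  from choice[OF this]
  obtain L where L: "\<And>u. rep (L u) u" "\<And>u m. rep m u \<Longrightarrow> cost (L u) \<le> cost m"
    by blast
  define p where "p u = cost (L u)" for u
  have "sublinear p"
  proof (rule sublinearI)
    fix x y
    have "rep (\<lambda>e. L x e + L y e) (x + y)"
      using L(1)[of x] L(1)[of y] by (simp add: rep_def scaleR_add_left sum.distrib)
    from L(2)[OF this] show "p (x + y) \<le> p x + p y"
      by (simp add: p_def cost_def algebra_simps sum.distrib)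
  next
    have "rep (\<lambda>_. 0) 0" by (simp add: rep_def)
    from L(2)[OF this] have "p 0 \<le> 0" by (simp add: p_def cost_def)
    moreover have "0 \<le> p 0"
      using L(1)[of 0] w unfolding p_def cost_def rep_def
      by (intro sum_nonneg mult_nonneg_nonneg) (auto simp: less_imp_le)
    ultimately show "p 0 = 0" by simp
  next
    fix c :: real and x assume c: "0 < c"
    then have "rep (\<lambda>e. c * L x e) (c *\<^sub>R x)"
      using L(1)[of x] by (auto simp: rep_def simp flip: scaleR_scaleR scaleR_sum_right)
    from L(2)[OF this] show "p (c *\<^sub>R x) \<le> c * p x"
      by (simp add: p_def cost_def sum_distrib_left mult.assoc)
  qed
  moreover have "span E = UNIV" by (rule span_UNIV_if_cone[OF cone])
  ultimately obtain f where f: "linear f" "\<And>y. f y \<le> p y" "f v = p v"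
    using supporting_functional[OF fin] by metis
  have le: "f e \<le> w e" if "e \<in> E" for e
  proof -
    \<comment> \<open>The element \<open>e\<close> represents itself at cost \<open>w e\<close>.\<close>
    have "rep (\<lambda>x. if x = e then 1 else 0) e"
      using that fin by (simp add: rep_def if_distrib[of "\<lambda>c. c *\<^sub>R _"] cong: if_cong)
    from L(2)[OF this] have "p e \<le> w e"
      using that fin by (simp add: p_def cost_def if_distrib[of "\<lambda>c. c * _"] cong: if_cong)
    with f(2)[of e] show ?thesis by simp
  qed
  have Lv: "\<And>e. e \<in> E \<Longrightarrow> 0 \<le> L v e" "(\<Sum>e\<in>E. L v e *\<^sub>R e) = v"
    using L(1)[of v] by (auto simp: rep_def)
  have slack: "L v e = 0" if "e \<in> E - contact_set E w f" for e
    using complementary_slackness[OF fin f(1) le, where l = "L v"] Lv that f(3)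
    by (simp add: p_def cost_def)
  have "v \<in> poly_cone (contact_set E w f)"
    using Lv slack
    by (intro poly_cone_support_iff[OF fin, THEN iffD2] exI[of _ "L v"]) (auto simp: contact_set_def)
  with that f(1) le show thesis by blast
qed


section \<open>Vertices of the dual polytope\<close>

text \<open>
  The spanning condition expresses that the constraints tight at \<open>f\<close> determine \<open>f\<close>, which
  characterises the vertices of the polytope \<open>{f. \<forall>e\<in>E. f e \<le> w e}\<close>.
\<close>
definition dual_vertex :: "'a::real_vector set \<Rightarrow> ('a \<Rightarrow> real) \<Rightarrow> ('a \<Rightarrow> real) \<Rightarrow> bool" where
  "dual_vertex E w f \<longleftrightarrow>
     linear f \<and> (\<forall>e\<in>E. f e \<le> w e) \<and> span (contact_set E w f) = UNIV"

lemma nonzero_functional_vanishing: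
  fixes T :: "'a::real_vector set"
  assumes "span T \<noteq> UNIV"
  obtains g :: "'a \<Rightarrow> real" and a where "linear g" "\<And>t. t \<in> T \<Longrightarrow> g t = 0" "g a \<noteq> 0"
proof -
  obtain a where a: "a \<notin> span T" using assms by blast
  obtain B where B: "B \<subseteq> T" "independent B" "T \<subseteq> span B"
    using maximal_independent_subset[of T] by blast
  have "span B = span T" using B by (simp add: span_eq span_superset subset_trans)
  with a have aB: "a \<notin> span B" by simp
  with B(2) have "independent (insert a B)" by (simp add: independent_insert)
  then obtain g :: "'a \<Rightarrow> real" where
      g: "linear g" "\<And>x. x \<in> insert a B \<Longrightarrow> g x = (if x = a then 1 else 0)"
    using linear_independent_extend[of "insert a B" "\<lambda>x. if x = a then 1 else (0::real)"] by blast
  have "g b = 0" if "b \<in> B" for b using g(2)[of b] that aB span_base[of b B] by auto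
  then have "g t = 0" if "t \<in> T" for t
    using linear_eq_0_on_span[OF g(1), of B t] B(3) that by blast
  moreover have "g a \<noteq> 0" using g(2)[of a] by simp
  ultimately show thesis using that[OF g(1)] by blast
qed

text \<open>
  As long as the contact set does not span, some nonzero functional \<open>g\<close> vanishes on it. Adding
  multiples of \<open>g\<close> keeps all contacts, and since \<open>E\<close> spans and is symmetric, \<open>g\<close> is positive
  somewhere on \<open>E\<close>, so a first new contact is reached. Each such step enlarges the contact set.
\<close>
lemma extend_to_dual_vertex:
  fixes E :: "'a::real_vector set"
  assumes fin: "finite E" and sym: "uminus ` E = E" and sp: "span E = UNIV"
    and f: "linear f" "\<And>e. e \<in> E \<Longrightarrow> f e \<le> w e"
  shows "\<exists>g. dual_vertex E w g \<and> contact_set E w f \<subseteq> contact_set E w g"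
  using f
proof (induction "card (E - contact_set E w f)" arbitrary: f rule: less_induct)
  case less
  let ?T = "contact_set E w f"
  show ?case
  proof (cases "span ?T = UNIV")
    case True
    with less.prems show ?thesis unfolding dual_vertex_def by blast
  next
    case False
    then obtain g :: "'a \<Rightarrow> real" and a where g: "linear g" "\<And>t. t \<in> ?T \<Longrightarrow> g t = 0" "g a \<noteq> 0"
      using nonzero_functional_vanishing by blast
    have "\<exists>e\<in>E. g e \<noteq> 0"
      using linear_eq_0_on_span[OF g(1), of E a] sp g(3) by auto
    then obtain e where e: "e \<in> E" "g e \<noteq> 0" by blast
    moreover from e sym have "- e \<in> E" by blast
    ultimately have "\<exists>e\<in>E. 0 < g e"
      using linear_neg[OF g(1), of e] by (metis linorder_neqE_linordered_idom neg_0_less_iff_less)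
    then have ne: "finite {e\<in>E. 0 < g e}" "{e\<in>E. 0 < g e} \<noteq> {}" using fin by auto
    obtain b where b: "b \<in> E" "0 < g b"
      and min: "\<And>e. e \<in> E \<Longrightarrow> 0 < g e \<Longrightarrow> (w b - f b) / g b \<le> (w e - f e) / g e"
      by (rule finite_minimizer[OF ne, of "\<lambda>e. (w e - f e) / g e"]) auto
    define s where "s = (w b - f b) / g b"
    have s: "0 \<le> s" using less.prems(2)[of b] b by (simp add: s_def)
    define h where "h e = f e + s * g e" for e
    have lin: "linear h"
      unfolding h_def using less.prems(1) g(1)
      by (intro linear_compose_add linear_compose_scale_right[where 'b = real, simplified])
    have le: "h e \<le> w e" if "e \<in> E" for e
    proof (cases "0 < g e")
      case True
      with min[OF that] show ?thesis by (simp add: h_def s_def field_simps)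
    next
      case False
      then have "s * g e \<le> 0" using s by (simp add: mult_nonneg_nonpos)
      with less.prems(2)[OF that] show ?thesis by (simp add: h_def)
    qed
    have sub: "?T \<subseteq> contact_set E w h"
      using g(2) by (auto simp: contact_set_def h_def)
    have "b \<in> contact_set E w h" "b \<notin> ?T"
      using b g(2)[of b] by (auto simp: contact_set_def h_def s_def)
    with sub b have "E - contact_set E w h \<subset> E - ?T" by auto
    then have "card (E - contact_set E w h) < card (E - ?T)"
      using fin by (intro psubset_card_mono) auto
    from less.hyps[OF this lin le] sub show ?thesis by blast
  qed
qed


section \<open>Generic symmetric perturbation of the weights\<close>

definition generic_weights :: "'a::real_vector set \<Rightarrow> ('a \<Rightarrow> real) \<Rightarrow> bool" where
  "generic_weights E w \<longleftrightarrow> (\<forall>f. linear f \<longrightarrow> independent (contact_set E w f))"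

text \<open>
  A linear relation \<open>\<Sum>e\<in>D. u e *\<^sub>R e = 0\<close> transfers to the values of any linear functional.
  For values \<open>w e + t ^ k e\<close> it reads \<open>P t = 0\<close> for a polynomial \<open>P\<close>, whose coefficient at the
  exponent \<open>k a\<close> is \<open>u a\<close> because the exponents are distinct and positive. So \<open>P\<close> is nonzero and
  has finitely many roots.
\<close>
lemma eventually_no_contact_on_dependent:
  fixes D :: "'a::real_vector set" and w :: "'a \<Rightarrow> real" and k :: "'a \<Rightarrow> nat"
  assumes fin: "finite D" and dep: "dependent D" and k: "inj_on k D" "\<And>e. e \<in> D \<Longrightarrow> 0 < k e"
  shows "\<forall>\<^sub>F t in at_right 0. \<not> (\<exists>f. linear f \<and> (\<forall>e\<in>D. f e = w e + t ^ k e))"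
proof -
  obtain u a where u: "a \<in> D" "u a \<noteq> 0" "(\<Sum>e\<in>D. u e *\<^sub>R e) = 0"
    using dependent_finite[OF fin] dep by blast
  define P where "P = (\<Sum>e\<in>D. smult (u e) ([:w e:] + monom 1 (k e)))"
  have summand: "coeff (smult (u e) ([:w e:] + monom 1 (k e))) (k a) = (if e = a then u e else 0)"
    if "e \<in> D" for e
  proof -
    have "k e = k a \<longleftrightarrow> e = a" using inj_on_eq_iff[OF k(1) that u(1)] .
    moreover have "coeff [:w e:] (k a) = 0" using k(2)[OF u(1)] by (cases "k a") auto
    ultimately show ?thesis by simp
  qed
  have "coeff P (k a) = (\<Sum>e\<in>D. if e = a then u e else 0)"
    unfolding P_def coeff_sum by (intro sum.cong refl summand)
  also have "\<dots> = u a" using fin u(1) by simp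
  finally have "P \<noteq> 0" using u(2) by auto
  then have "finite {t. poly P t = 0}" by (rule poly_roots_finite)
  then have "\<forall>\<^sub>F t in at_right 0. \<forall>z\<in>{t. poly P t = 0}. t \<noteq> z"
    by (intro eventually_ball_finite) (auto simp: eventually_neq_at_within)
  then show ?thesis
  proof eventually_elim
    case (elim t)
    have "poly P t = f (\<Sum>e\<in>D. u e *\<^sub>R e)" if "linear f" "\<forall>e\<in>D. f e = w e + t ^ k e" for f
      using that(2) by (simp add: P_def poly_sum poly_monom linear_sum[OF that(1)]
          linear_cmul[OF that(1)])
    then have "poly P t = 0" if "linear f" "\<forall>e\<in>D. f e = w e + t ^ k e" for f
      using that u(3) by (simp add: linear_0)
    with elim show ?case by blast
  qed
qed

text \<open>
  The functional interpolating prescribed values on a basis depends continuously on these values. If it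
  violates a constraint strictly for the weight \<open>w\<close>, it does so for all small \<open>t\<close>.
\<close>
lemma eventually_basis_stays_feasible:
  fixes E :: "'a::real_vector set" and w :: "'a \<Rightarrow> real" and k :: "'a \<Rightarrow> nat"
  assumes fin: "finite E" and S: "S \<subseteq> E" "independent S" "span S = UNIV"
    and k: "\<And>e. e \<in> E \<Longrightarrow> 0 < k e"
  shows "\<forall>\<^sub>F t in at_right 0.
    (\<exists>f. linear f \<and> (\<forall>e\<in>S. f e = w e + t ^ k e) \<and> (\<forall>e\<in>E. f e \<le> w e + t ^ k e)) \<longrightarrow>
    (\<exists>g. linear g \<and> (\<forall>e\<in>S. g e = w e) \<and> (\<forall>e\<in>E. g e \<le> w e))"
proof -
  obtain g where g: "linear g" "\<forall>e\<in>S. g e = w e"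
    using linear_independent_extend[OF S(2), of w] by blast
  show ?thesis
  proof (cases "\<forall>e\<in>E. g e \<le> w e")
    case True
    with g show ?thesis by (intro always_eventually) blast
  next
    case False
    then obtain e where e: "e \<in> E" "w e < g e" by force
    have finS: "finite S" using fin S(1) by (rule finite_subset[rotated])
    define r where "r = representation S e"
    have rep: "(\<Sum>s\<in>S. r s *\<^sub>R s) = e"
      unfolding r_def using S finS by (intro sum_representation_eq) auto
    have val: "f e = (\<Sum>s\<in>S. r s * h s)" if "linear f" "\<forall>s\<in>S. f s = h s" for f h
    proof -
      have "f (\<Sum>s\<in>S. r s *\<^sub>R s) = (\<Sum>s\<in>S. r s * h s)"
        using that(2) by (simp add: linear_sum[OF that(1)] linear_cmul[OF that(1)])
      with rep show ?thesis by simp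
    qed
    \<comment> \<open>\<open>\<delta> t\<close> is the excess of the interpolating functional over the weight at \<open>e\<close>, both taken
        at parameter \<open>t\<close>.\<close>
    define \<delta> where "\<delta> t = (\<Sum>s\<in>S. r s * (w s + t ^ k s)) - (w e + t ^ k e)" for t
    have "(\<delta> \<longlongrightarrow> \<delta> 0) (at_right 0)"
      unfolding \<delta>_def by (intro tendsto_intros)
    moreover have "0 < \<delta> 0"
    proof -
      have "\<delta> 0 = (\<Sum>s\<in>S. r s * w s) - w e"
      proof -
        have zero: "(0::real) ^ k a = 0" if "a \<in> E" for a using k[OF that] by simp
        have "(\<Sum>s\<in>S. r s * (w s + 0 ^ k s)) = (\<Sum>s\<in>S. r s * w s)"
          by (intro sum.cong refl) (simp add: zero subsetD[OF S(1)])
        with zero[OF e(1)] show ?thesis by (simp add: \<delta>_def)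
      qed
      with val[OF g] e(2) show ?thesis by simp
    qed
    ultimately have "\<forall>\<^sub>F t in at_right 0. 0 < \<delta> t" by (rule order_tendstoD)
    then show ?thesis
    proof eventually_elim
      case (elim t)
      have "w e + t ^ k e < f e" if "linear f" "\<forall>s\<in>S. f s = w s + t ^ k s" for f
        using val[OF that] elim by (simp add: \<delta>_def)
      with e(1) show ?case by (meson not_less)
    qed
  qed
qed

text \<open>
  The perturbed weight is \<open>w e + t ^ k e\<close>. Antipodal elements share their exponent, which keeps the
  weight even; they never lie in a common contact set, since \<open>f e = w' e > 0\<close> excludes
  \<open>f (- e) = w' (- e) > 0\<close>. On contact sets the exponents are therefore distinct, and the two preceding
  lemmas apply to the finitely many subsets of \<open>E\<close>.
\<close>
lemma generic_symmetric_weights: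
  fixes E :: "'a::real_vector set" and w :: "'a \<Rightarrow> real"
  assumes fin: "finite E"
    and w: "\<And>e. e \<in> E \<Longrightarrow> 0 < w e" "\<And>e. e \<in> E \<Longrightarrow> w (- e) = w e"
  obtains w' where "\<And>e. e \<in> E \<Longrightarrow> 0 < w' e" "\<And>e. e \<in> E \<Longrightarrow> w' (- e) = w' e"
    "generic_weights E w'"
    "\<And>f. dual_vertex E w' f \<Longrightarrow>
      \<exists>g. linear g \<and> (\<forall>e\<in>E. g e \<le> w e) \<and> contact_set E w' f \<subseteq> contact_set E w g"
proof -
  have "finite ((\<lambda>e. {e, - e}) ` E)" using fin by simp
  from finite_imp_inj_to_nat_seg[OF this]
  obtain h :: "'a set \<Rightarrow> nat" where h: "inj_on h ((\<lambda>e. {e, - e}) ` E)"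
    by blast
  define k where "k e = Suc (h {e, - e})" for e
  have k_pos: "0 < k e" and k_minus: "k (- e) = k e" for e
    by (auto simp: k_def insert_commute)
  have k_inj: "e = e' \<or> e = - e'" if "e \<in> E" "e' \<in> E" "k e = k e'" for e e'
    using inj_onD[OF h, of "{e, - e}" "{e', - e'}"] that by (auto simp: k_def doubleton_eq_iff)
  define W where "W t e = w e + t ^ k e" for t e
  \<comment> \<open>Dependent sets must be excluded as contact sets, and bases must not become feasible through
      the perturbation.\<close>
  let ?\<D> = "{D \<in> Pow E. inj_on k D \<and> dependent D}"
  let ?\<S> = "{S \<in> Pow E. independent S \<and> span S = UNIV}"
  have "\<forall>\<^sub>F t in at_right 0. \<forall>D\<in>?\<D>. \<not> (\<exists>f. linear f \<and> (\<forall>e\<in>D. f e = W t e))"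
    unfolding W_def using fin k_pos finite_subset[OF _ fin]
    by (intro eventually_ball_finite ballI eventually_no_contact_on_dependent) auto
  moreover have "\<forall>\<^sub>F t in at_right 0. \<forall>S\<in>?\<S>.
      (\<exists>f. linear f \<and> (\<forall>e\<in>S. f e = W t e) \<and> (\<forall>e\<in>E. f e \<le> W t e)) \<longrightarrow>
      (\<exists>g. linear g \<and> (\<forall>e\<in>S. g e = w e) \<and> (\<forall>e\<in>E. g e \<le> w e))"
    unfolding W_def using fin k_pos
    by (intro eventually_ball_finite ballI eventually_basis_stays_feasible) auto
  ultimately have "\<forall>\<^sub>F t in at_right 0. 0 < t \<and>
      (\<forall>D\<in>?\<D>. \<not> (\<exists>f. linear f \<and> (\<forall>e\<in>D. f e = W t e))) \<and>
      (\<forall>S\<in>?\<S>. (\<exists>f. linear f \<and> (\<forall>e\<in>S. f e = W t e) \<and> (\<forall>e\<in>E. f e \<le> W t e)) \<longrightarrow>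
        (\<exists>g. linear g \<and> (\<forall>e\<in>S. g e = w e) \<and> (\<forall>e\<in>E. g e \<le> w e)))"
    using eventually_at_right_less[of "0::real"] by eventually_elim blast
  from eventually_happens'[OF trivial_limit_at_right_real this]
  obtain t :: real where t: "0 < t"
    and dep': "\<forall>D\<in>?\<D>. \<not> (\<exists>f. linear f \<and> (\<forall>e\<in>D. f e = W t e))"
    and basis': "\<forall>S\<in>?\<S>.
      (\<exists>f. linear f \<and> (\<forall>e\<in>S. f e = W t e) \<and> (\<forall>e\<in>E. f e \<le> W t e)) \<longrightarrow>
      (\<exists>g. linear g \<and> (\<forall>e\<in>S. g e = w e) \<and> (\<forall>e\<in>E. g e \<le> w e))"
    by (elim exE conjE)
  have dep: "\<not> (\<forall>e\<in>D. f e = W t e)"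
    if "D \<subseteq> E" "inj_on k D" "dependent D" "linear f" for D f
    using bspec[OF dep', of D] that by blast
  have basis: "\<exists>g. linear g \<and> (\<forall>e\<in>S. g e = w e) \<and> (\<forall>e\<in>E. g e \<le> w e)"
    if "S \<subseteq> E" "independent S" "span S = UNIV" "linear f" "\<forall>e\<in>S. f e = W t e"
      "\<forall>e\<in>E. f e \<le> W t e" for S f
    using bspec[OF basis', of S] that by blast
  have pos: "0 < W t e" if "e \<in> E" for e
    using w(1)[OF that] t by (simp add: W_def add_pos_pos)
  have even: "W t (- e) = W t e" if "e \<in> E" for e
    using w(2)[OF that] by (simp add: W_def k_minus)
  have gen: "generic_weights E (W t)"
    unfolding generic_weights_def
  proof (intro allI impI)
    fix f :: "'a \<Rightarrow> real" assume f: "linear f"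
    let ?T = "contact_set E (W t) f"
    have "inj_on k ?T"
    proof (rule inj_onI)
      fix a b assume ab: "a \<in> ?T" "b \<in> ?T" "k a = k b"
      then consider "a = b" | "a = - b" using k_inj[of a b] by (auto simp: contact_set_def)
      then show "a = b"
      proof cases
        case 2
        then have "f a = - f b" by (simp add: linear_neg[OF f])
        moreover have "f a = W t a" "f b = W t b" "0 < W t a" "0 < W t b"
          using ab pos by (auto simp: contact_set_def)
        ultimately show ?thesis by simp
      qed
    qed
    then show "independent ?T"
      using dep[of ?T f] f by (auto simp: contact_set_def)
  qed
  have vertex: "\<exists>g. linear g \<and> (\<forall>e\<in>E. g e \<le> w e) \<and> contact_set E (W t) f \<subseteq> contact_set E w g"
    if "dual_vertex E (W t) f" for f
  proof -
    let ?T = "contact_set E (W t) f"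
    have f: "linear f" "\<forall>e\<in>E. f e \<le> W t e" "span ?T = UNIV"
      using that by (auto simp: dual_vertex_def)
    have "independent ?T" using gen f(1) by (simp add: generic_weights_def)
    moreover have "?T \<subseteq> E" "\<forall>e\<in>?T. f e = W t e" by (auto simp: contact_set_def)
    ultimately obtain g where g: "linear g" "\<forall>e\<in>?T. g e = w e" "\<forall>e\<in>E. g e \<le> w e"
      using basis[of ?T f] f by blast
    then have "?T \<subseteq> contact_set E w g" by (auto simp: contact_set_def)
    with g show ?thesis by blast
  qed
  show thesis by (rule that[of "W t", OF pos even gen vertex])
qed


section \<open>The fan of a generic weight\<close>

definition contact_fan :: "'a::real_vector set \<Rightarrow> ('a \<Rightarrow> real) \<Rightarrow> 'a set set" where
  "contact_fan E w = {poly_cone Y | Y. \<exists>f. dual_vertex E w f \<and> Y \<subseteq> contact_set E w f}"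

text \<open>
  A vector in both cones has the same cost in its two representations: each is optimal, as its support
  lies in a contact set. By complementary slackness the representation over \<open>Z\<close> then also lives on
  the contact set of \<open>f\<close>, where, that set being independent, it coincides with the representation over
  \<open>Y\<close>.
\<close>
lemma contact_cones_Int:
  assumes fin: "finite E" and gen: "generic_weights E w"
    and f: "linear f" "\<And>e. e \<in> E \<Longrightarrow> f e \<le> w e" and Y: "Y \<subseteq> contact_set E w f"
    and g: "linear g" "\<And>e. e \<in> E \<Longrightarrow> g e \<le> w e" and Z: "Z \<subseteq> contact_set E w g"
  shows "poly_cone Y \<inter> poly_cone Z = poly_cone (Y \<inter> Z)"
proof
  let ?T = "contact_set E w f"
  have YE: "Y \<subseteq> E" and ZE: "Z \<subseteq> E" and TE: "?T \<subseteq> E"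
    using Y Z by (auto simp: contact_set_def)
  have finT: "finite ?T" using fin TE by (rule finite_subset[rotated])
  show "poly_cone (Y \<inter> Z) \<subseteq> poly_cone Y \<inter> poly_cone Z"
    using poly_cone_mono[of Y "Y \<inter> Z"] poly_cone_mono[of Z "Y \<inter> Z"]
      finite_subset[OF YE fin] finite_subset[OF ZE fin] by blast
  show "poly_cone Y \<inter> poly_cone Z \<subseteq> poly_cone (Y \<inter> Z)"
  proof
    fix v assume v: "v \<in> poly_cone Y \<inter> poly_cone Z"
    obtain l where l: "\<forall>e\<in>E. 0 \<le> l e" "\<forall>e\<in>E - Y. l e = 0" "v = (\<Sum>e\<in>E. l e *\<^sub>R e)"
      using v poly_cone_support_iff[OF fin YE, of v] by blast
    obtain m where m: "\<forall>e\<in>E. 0 \<le> m e" "\<forall>e\<in>E - Z. m e = 0" "v = (\<Sum>e\<in>E. m e *\<^sub>R e)"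
      using v poly_cone_support_iff[OF fin ZE, of v] by blast
    have "(\<Sum>e\<in>E. m e * w e) = g v"
      unfolding m(3) linear_sum[OF g(1)] linear_cmul[OF g(1)]
      using m(2) Z by (intro sum.cong) (auto simp: contact_set_def)
    also have "\<dots> \<le> (\<Sum>e\<in>E. l e * w e)"
      unfolding l(3) linear_sum[OF g(1)] linear_cmul[OF g(1)]
      using l(1) g(2) by (auto intro!: sum_mono mult_left_mono)
    also have "\<dots> = f v"
      unfolding l(3) linear_sum[OF f(1)] linear_cmul[OF f(1)]
      using l(2) Y by (intro sum.cong) (auto simp: contact_set_def)
    finally have "(\<Sum>e\<in>E. m e * w e) \<le> f (\<Sum>e\<in>E. m e *\<^sub>R e)" using m(3) by simp
    then have mT: "m e = 0" if "e \<in> E - ?T" for e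
      using complementary_slackness[OF fin f, where l = m] m(1) that by blast
    have "(\<Sum>e\<in>?T. l e *\<^sub>R e) = v"
      unfolding l(3) using fin TE l(2) Y by (intro sum.mono_neutral_left) auto
    also have "v = (\<Sum>e\<in>?T. m e *\<^sub>R e)"
      unfolding m(3) using fin TE mT by (intro sum.mono_neutral_right) auto
    finally have lm: "l e = m e" if "e \<in> ?T" for e
      using independent_coeffs_unique[OF finT _ _ that, where l = l and m = m] gen f(1)
      by (simp add: generic_weights_def)
    have "l e = 0" if "e \<in> E - (Y \<inter> Z)" for e
    proof (cases "e \<in> Y")
      case True
      with that Y lm[of e] m(2) show ?thesis by auto
    next
      case False
      with that l(2) show ?thesis by simp
    qed
    with l YE show "v \<in> poly_cone (Y \<inter> Z)"
      by (intro poly_cone_support_iff[OF fin, THEN iffD2] exI[of _ l]) auto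
  qed
qed

lemma fan_contact_fan:
  assumes fin: "finite E" and gen: "generic_weights E w"
  shows "fan (contact_fan E w)"
    and "simplicial_fan (contact_fan E w)"
    and "E_fan E (contact_fan E w)"
proof -
  have gens: "Y \<subseteq> E" "finite Y" "independent Y"
    if "dual_vertex E w f" "Y \<subseteq> contact_set E w f" for Y f
  proof -
    show "Y \<subseteq> E" using that by (auto simp: contact_set_def)
    then show "finite Y" using fin by (rule finite_subset)
    show "independent Y"
      using independent_mono[OF _ that(2)] that(1) gen
      by (simp add: generic_weights_def dual_vertex_def)
  qed
  have cone: "\<exists>Y. Y \<subseteq> E \<and> finite Y \<and> independent Y \<and> C = poly_cone Y"
    if C: "C \<in> contact_fan E w" for C
  proof -
    obtain Y f where "C = poly_cone Y" "dual_vertex E w f" "Y \<subseteq> contact_set E w f"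
      using C unfolding contact_fan_def by blast
    with gens[of f Y] show ?thesis by blast
  qed
  show fan: "fan (contact_fan E w)"
    unfolding fan_def
  proof (intro conjI ballI allI impI)
    have "contact_fan E w \<subseteq> poly_cone ` Pow E" using cone by blast
    then show "finite (contact_fan E w)" using fin by (auto intro: finite_subset)
    show "polyhedral_cone C" if "C \<in> contact_fan E w" for C
      using cone[OF that] unfolding polyhedral_cone_def by blast
    show "G \<in> contact_fan E w" if C: "C \<in> contact_fan E w" and G: "cone_face G C" for C G
    proof -
      obtain Y f where Y: "C = poly_cone Y" "dual_vertex E w f" "Y \<subseteq> contact_set E w f"
        using C unfolding contact_fan_def by blast
      have "G = poly_cone (Y \<inter> G)"
        using face_of_poly_cone_generated[of Y G] gens(2)[OF Y(2,3)] G Y(1) by simp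
      moreover have "Y \<inter> G \<subseteq> contact_set E w f" using Y(3) by blast
      ultimately show ?thesis using Y(2) unfolding contact_fan_def by blast
    qed
    fix C D assume "C \<in> contact_fan E w" "D \<in> contact_fan E w"
    then obtain Y f Z g where Y: "C = poly_cone Y" "dual_vertex E w f" "Y \<subseteq> contact_set E w f"
      and Z: "D = poly_cone Z" "dual_vertex E w g" "Z \<subseteq> contact_set E w g"
      unfolding contact_fan_def by blast
    have "C \<inter> D = poly_cone (Y \<inter> Z)"
      unfolding Y(1) Z(1) using Y(2) Z(2)
      by (intro contact_cones_Int[OF fin gen _ _ Y(3) _ _ Z(3)]) (auto simp: dual_vertex_def)
    then show "cone_face (C \<inter> D) C" "cone_face (C \<inter> D) D"
      using sub_cone_face[OF gens(2,3)[OF Y(2,3)], of "Y \<inter> Z"]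
        sub_cone_face[OF gens(2,3)[OF Z(2,3)], of "Y \<inter> Z"] Y(1) Z(1) by auto
  qed
  show "simplicial_fan (contact_fan E w)"
    unfolding simplicial_fan_def using fan cone by blast
  show "E_fan E (contact_fan E w)"
    unfolding E_fan_def using fan cone by blast
qed

lemma complete_contact_fan:
  assumes fin: "finite E" and sym: "uminus ` E = E" and cone: "poly_cone E = UNIV"
    and w: "\<And>e. e \<in> E \<Longrightarrow> 0 < w e" and gen: "generic_weights E w"
  shows "complete_fan (contact_fan E w)"
proof -
  have "v \<in> \<Union> (contact_fan E w)" for v
  proof -
    obtain f where f: "linear f" "\<And>e. e \<in> E \<Longrightarrow> f e \<le> w e" "v \<in> poly_cone (contact_set E w f)"
      using weighted_cone_duality[OF fin _ cone, where w = w and v = v] w by blast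
    obtain g where g: "dual_vertex E w g" "contact_set E w f \<subseteq> contact_set E w g"
      using extend_to_dual_vertex[OF fin sym span_UNIV_if_cone[OF cone] f(1), where w = w] f(2)
      by blast
    have "contact_set E w g \<subseteq> E" by (auto simp: contact_set_def)
    then have "finite (contact_set E w g)" using fin by (rule finite_subset)
    then have "v \<in> poly_cone (contact_set E w g)"
      using poly_cone_mono[OF _ g(2)] f(3) by blast
    with g(1) show ?thesis unfolding contact_fan_def by blast
  qed
  then show ?thesis
    using fan_contact_fan(1)[OF fin gen] unfolding complete_fan_def by blast
qed

lemma symmetric_contact_fan:
  assumes fin: "finite E" and sym: "uminus ` E = E"
    and w: "\<And>e. e \<in> E \<Longrightarrow> w (- e) = w e" and gen: "generic_weights E w"
  shows "symmetric_fan (contact_fan E w)"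
proof -
  have "uminus ` C \<in> contact_fan E w" if C: "C \<in> contact_fan E w" for C
  proof -
    obtain Y f where Y: "C = poly_cone Y" "dual_vertex E w f" "Y \<subseteq> contact_set E w f"
      using C unfolding contact_fan_def by blast
    then have f: "linear f" "\<And>e. e \<in> E \<Longrightarrow> f e \<le> w e" "span (contact_set E w f) = UNIV"
      by (auto simp: dual_vertex_def)
    have minus: "- e \<in> E" if "e \<in> E" for e using sym that by blast
    have sub: "uminus ` contact_set E w f \<subseteq> contact_set E w (\<lambda>v. - f v)"
      using w minus by (auto simp: contact_set_def linear_neg[OF f(1)])
    have "span (uminus ` contact_set E w f) = UNIV"
    proof -
      have "span (uminus ` contact_set E w f) = uminus ` span (contact_set E w f)"
        by (rule span_linear_image) (simp add: linear_uminus)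
      with f(3) show ?thesis by simp
    qed
    with sub have "span (contact_set E w (\<lambda>v. - f v)) = UNIV"
      using span_mono by blast
    moreover have "linear (\<lambda>v. - f v)" using f(1) by (rule linear_compose_neg)
    moreover have "- f e \<le> w e" if "e \<in> E" for e
      using f(2)[OF minus[OF that]] w[OF that] by (simp add: linear_neg[OF f(1)])
    ultimately have "dual_vertex E w (\<lambda>v. - f v)" by (simp add: dual_vertex_def)
    moreover have "uminus ` Y \<subseteq> contact_set E w (\<lambda>v. - f v)" using sub Y(3) by blast
    moreover have "uminus ` C = poly_cone (uminus ` Y)" using Y(1) by (simp add: uminus_poly_cone)
    ultimately show ?thesis unfolding contact_fan_def by blast
  qed
  then show ?thesis
    using fan_contact_fan(1)[OF fin gen] unfolding symmetric_fan_def by blast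
qed


section \<open>The functional rho on the cones of contact\<close>

lemma convex_shrink:
  assumes "convex K" "0 \<in> K" "y \<in> K" "0 \<le> c" "c \<le> 1"
  shows "c *\<^sub>R y \<in> K"
  using convexD[OF assms(1,3,2), of c "1 - c"] assms(4,5) by simp

lemma convex_conv_scaled: "convex (conv_scaled n x \<alpha>)"
  by (simp add: conv_scaled_def)

lemma generator_in_conv_scaled:
  assumes "i \<in> {1..n}" "e \<in> {x i, - x i}"
  shows "inverse (\<alpha> i) *\<^sub>R e \<in> conv_scaled n x \<alpha>"
  unfolding conv_scaled_def using assms by (intro hull_inc) auto

lemma uminus_conv_scaled: "v \<in> conv_scaled n x \<alpha> \<Longrightarrow> - v \<in> conv_scaled n x \<alpha>"
proof -
  let ?G = "\<Union>i\<in>{1..n}. {inverse (\<alpha> i) *\<^sub>R x i, - (inverse (\<alpha> i) *\<^sub>R x i)}"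
  have "uminus ` ?G \<subseteq> ?G" by auto
  then have "convex hull (uminus ` ?G) \<subseteq> convex hull ?G" by (rule hull_mono)
  moreover have "uminus ` (convex hull ?G) = convex hull (uminus ` ?G)"
    by (rule convex_hull_linear_image) (simp add: linear_uminus)
  ultimately show "v \<in> conv_scaled n x \<alpha> \<Longrightarrow> - v \<in> conv_scaled n x \<alpha>"
    unfolding conv_scaled_def by blast
qed

lemma zero_in_conv_scaled:
  assumes "v \<in> conv_scaled n x \<alpha>"
  shows "0 \<in> conv_scaled n x \<alpha>"
  using convexD[OF convex_conv_scaled assms uminus_conv_scaled[OF assms], of "1/2" "1/2"] by simp

lemma rho_alt: "rho n x \<alpha> v = Inf {r. 0 < r \<and> inverse r *\<^sub>R v \<in> conv_scaled n x \<alpha>}"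
proof -
  have "v \<in> (\<lambda>y. r *\<^sub>R y) ` K \<longleftrightarrow> inverse r *\<^sub>R v \<in> K" if "0 < r" for r and K :: "'a set"
    using that by (force simp: image_iff)
  then show ?thesis unfolding rho_def by (intro arg_cong[where f = Inf]) auto
qed

text \<open>
  If \<open>\<rho> e < \<alpha> i\<close>, then \<open>e / r\<close> lies in the unit ball for some \<open>r < \<alpha> i\<close>. Lowering \<open>\<alpha> i\<close>
  to \<open>r\<close> replaces the generators \<open>\<plusminus> x i / \<alpha> i\<close> by the points \<open>\<plusminus> x i / r\<close> of the ball, whose
  convex hull contains the old generators; the ball is unchanged, against admissibility.
\<close>
lemma admissible_rho_generator:
  assumes adm: "admissible n x \<alpha>" and i: "i \<in> {1..n}" and e: "e \<in> {x i, - x i}"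
  shows "rho n x \<alpha> e = \<alpha> i"
proof (rule ccontr)
  assume ne: "rho n x \<alpha> e \<noteq> \<alpha> i"
  let ?K = "conv_scaled n x \<alpha>" and ?R = "{r. 0 < r \<and> inverse r *\<^sub>R e \<in> conv_scaled n x \<alpha>}"
  have pos: "0 < \<alpha> i" using adm i by (auto simp: admissible_def positive_multiindex_def)
  have mem: "\<alpha> i \<in> ?R" using pos generator_in_conv_scaled[of i n e x \<alpha>, OF i e] by simp
  have "bdd_below ?R" by (auto intro: bdd_belowI[of _ 0])
  with mem have "Inf ?R \<le> \<alpha> i" by (rule cInf_lower)
  with ne have "Inf ?R < \<alpha> i" by (simp add: rho_alt)
  then obtain r where r: "r \<in> ?R" "r < \<alpha> i" using cInf_lessD[of ?R] mem by blast
  then have r0: "0 < r" and re: "inverse r *\<^sub>R e \<in> ?K" by auto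
  let ?K' = "conv_scaled n x (\<alpha>(i := r))"
  have gen: "inverse r *\<^sub>R x i \<in> ?K" "- (inverse r *\<^sub>R x i) \<in> ?K"
    using re uminus_conv_scaled[OF re] e by auto
  have gen': "inverse r *\<^sub>R x i \<in> ?K'" "- (inverse r *\<^sub>R x i) \<in> ?K'"
    using generator_in_conv_scaled[of i n "x i" x "\<alpha>(i := r)", OF i]
      generator_in_conv_scaled[of i n "- x i" x "\<alpha>(i := r)", OF i] by auto
  have shrink: "inverse (\<alpha> i) *\<^sub>R x i \<in> ?K'" "- (inverse (\<alpha> i) *\<^sub>R x i) \<in> ?K'"
    using convex_shrink[OF convex_conv_scaled zero_in_conv_scaled[OF gen'(1)] gen'(1), of "r / \<alpha> i"]
      convex_shrink[OF convex_conv_scaled zero_in_conv_scaled[OF gen'(1)] gen'(2), of "r / \<alpha> i"]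
      r0 r(2) pos by (auto simp: field_simps)
  have "?K' \<subseteq> ?K"
    unfolding conv_scaled_def[of n x "\<alpha>(i := r)"]
    using gen generator_in_conv_scaled[of _ n _ x \<alpha>] convex_conv_scaled[of n x \<alpha>]
    by (intro hull_minimal) fastforce+
  moreover have "?K \<subseteq> ?K'"
  proof -
    have "inverse (\<alpha> j) *\<^sub>R u \<in> ?K'" if "j \<in> {1..n}" "u \<in> {x j, - x j}" for j u
      using generator_in_conv_scaled[of j n u x "\<alpha>(i := r)", OF that] shrink that by (cases "j = i") auto
    then show ?thesis
      unfolding conv_scaled_def[of n x \<alpha>]
      using convex_conv_scaled[of n x "\<alpha>(i := r)"] by (intro hull_minimal) fastforce+
  qed
  ultimately have "?K' = ?K" by blast
  then have "rho n x (\<alpha>(i := \<alpha> i - (\<alpha> i - r))) = rho n x \<alpha>"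
    by (simp add: rho_def fun_eq_iff)
  moreover have "0 < \<alpha> i - r" "\<alpha> i - r < \<alpha> i" using r0 r(2) by auto
  ultimately show False using adm i unfolding admissible_def by blast
qed

text \<open>
  The bound \<open>f v \<le> \<rho> v\<close> holds since \<open>f \<le> 1\<close> on the generators of the unit ball. Conversely, a
  representation \<open>v = (\<Sum>e. l e *\<^sub>R e)\<close> over the contact set has cost \<open>f v\<close>, and dividing by
  \<open>f v\<close> exhibits \<open>v / f v\<close> as a convex combination of the points \<open>e / w e\<close> of the ball.
\<close>
lemma rho_eq_functional:
  fixes x :: "nat \<Rightarrow> 'a::real_vector"
  assumes n: "1 \<le> n" and E: "E = (\<Union>i\<in>{1..n}. {x i, - x i})"
    and pos: "positive_multiindex n \<alpha>"
    and w: "\<And>i e. i \<in> {1..n} \<Longrightarrow> e \<in> {x i, - x i} \<Longrightarrow> w e = \<alpha> i"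
    and f: "linear f" "\<And>e. e \<in> E \<Longrightarrow> f e \<le> w e"
    and v: "v \<in> poly_cone (contact_set E w f)"
  shows "rho n x \<alpha> v = f v"
proof -
  let ?K = "conv_scaled n x \<alpha>" and ?T = "contact_set E w f"
  let ?R = "{r. 0 < r \<and> inverse r *\<^sub>R v \<in> ?K}"
  have fin: "finite ?T" by (simp add: contact_set_def E)
  have w_pos: "0 < w e" and w_gen: "inverse (w e) *\<^sub>R e \<in> ?K" if "e \<in> E" for e
    using that pos w generator_in_conv_scaled[of _ n e x \<alpha>]
    by (auto simp: E positive_multiindex_def)
  have zero: "0 \<in> ?K"
    using zero_in_conv_scaled generator_in_conv_scaled[of 1 n "x 1" x \<alpha>] n by simp
  have "?K \<subseteq> {y. f y \<le> 1}"
    unfolding conv_scaled_def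
  proof (rule hull_minimal)
    show "convex {y. f y \<le> 1}"
      using convex_linear_vimage[OF f(1), of "{..1}"] by (simp add: vimage_def)
    have "f (inverse (\<alpha> i) *\<^sub>R e) \<le> 1" if "i \<in> {1..n}" "e \<in> {x i, - x i}" for i e
    proof -
      have "e \<in> E" using that unfolding E by blast
      from f(2)[OF this] w_pos[OF this] show ?thesis
        unfolding w[OF that] by (simp add: linear_cmul[OF f(1)] field_simps)
    qed
    then show "(\<Union>i\<in>{1..n}. {inverse (\<alpha> i) *\<^sub>R x i, - (inverse (\<alpha> i) *\<^sub>R x i)}) \<subseteq> {y. f y \<le> 1}"
      by fastforce
  qed
  then have lower: "f v \<le> r" if "r \<in> ?R" for r
    using that by (auto simp: linear_cmul[OF f(1)] field_simps)
  obtain l where l: "\<forall>e\<in>?T. 0 \<le> l e" "v = (\<Sum>e\<in>?T. l e *\<^sub>R e)"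
    using v by (auto simp: poly_cone_def)
  have fv: "f v = (\<Sum>e\<in>?T. l e * w e)"
    unfolding l(2) linear_sum[OF f(1)] linear_cmul[OF f(1)]
    by (intro sum.cong) (auto simp: contact_set_def)
  have T_pos: "0 < w e" if "e \<in> ?T" for e using that w_pos by (simp add: contact_set_def)
  have nonneg: "\<forall>e\<in>?T. 0 \<le> l e * w e" using l(1) T_pos by (auto simp: less_imp_le)
  then have "0 \<le> f v" unfolding fv by (auto intro: sum_nonneg)
  then consider "0 < f v" | "f v = 0" by linarith
  then show ?thesis
  proof cases
    case 1
    have "(\<Sum>e\<in>?T. (l e * w e / f v) *\<^sub>R (inverse (w e) *\<^sub>R e)) \<in> ?K"
    proof (rule convex_sum[OF fin convex_conv_scaled])
      show "(\<Sum>e\<in>?T. l e * w e / f v) = 1"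
        using 1 by (simp add: fv flip: sum_divide_distrib)
      show "0 \<le> l e * w e / f v" if "e \<in> ?T" for e using that nonneg 1 by simp
      show "inverse (w e) *\<^sub>R e \<in> ?K" if "e \<in> ?T" for e
        using that w_gen by (simp add: contact_set_def)
    qed
    also have "(\<Sum>e\<in>?T. (l e * w e / f v) *\<^sub>R (inverse (w e) *\<^sub>R e)) =
        (\<Sum>e\<in>?T. inverse (f v) *\<^sub>R (l e *\<^sub>R e))"
      using T_pos by (intro sum.cong) (force simp: field_simps)+
    also have "\<dots> = inverse (f v) *\<^sub>R v" unfolding l(2) by (rule scaleR_sum_right[symmetric])
    finally have "f v \<in> ?R" using 1 by simp
    then show ?thesis unfolding rho_alt using lower by (intro cInf_eq_minimum) auto
  next
    case 2
    have "\<forall>e\<in>?T. l e * w e = 0"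
      using 2 nonneg fin unfolding fv by (simp add: sum_nonneg_eq_0_iff)
    then have "l e = 0" if "e \<in> ?T" for e using T_pos that by force
    then have "v = 0" unfolding l(2) by simp
    with zero have "?R = {0<..}" by auto
    with 2 show ?thesis unfolding rho_alt by simp
  qed
qed


section \<open>Direction sets and the theorem\<close>

text \<open>
  Differences of points of a ball inside \<open>convex hull E\<close> reach every direction.
\<close>
lemma span_direction_set:
  assumes "direction_set E"
  shows "span E = UNIV"
proof -
  obtain a r where r: "0 < r" "ball a r \<subseteq> convex hull E"
    using assms unfolding direction_set_def mem_interior by (metis all_not_in_conv mem_interior)
  then have sub: "ball a r \<subseteq> span E" using convex_hull_subset_span by blast
  have "v \<in> span E" for v
  proof (cases "v = 0")
    case False
    define s where "s = r / (2 * norm v)"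
    have "a \<in> span E" "a + s *\<^sub>R v \<in> span E"
      using sub r False by (auto simp: s_def dist_norm intro!: subsetD[OF sub])
    then have "(a + s *\<^sub>R v) - a \<in> span E" by (intro span_diff)
    then have "s *\<^sub>R v \<in> span E" by simp
    from span_scale[OF this, of "inverse s"] show ?thesis using r False by (simp add: s_def)
  qed (simp add: span_zero)
  then show ?thesis by blast
qed

text \<open>
  A negative coefficient at \<open>e\<close> is the same as a positive coefficient at \<open>- e\<close>.
\<close>
lemma symmetric_span_eq_cone:
  assumes fin: "finite E" and sym: "uminus ` E = E" and sp: "span E = UNIV"
  shows "poly_cone E = UNIV"
proof -
  have "v \<in> poly_cone E" for v
  proof -
    have "v \<in> range (\<lambda>u. \<Sum>e\<in>E. u e *\<^sub>R e)" using span_finite[OF fin] sp by auto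
    then obtain u where u: "v = (\<Sum>e\<in>E. u e *\<^sub>R e)" by blast
    have "(\<Sum>e\<in>E. max 0 (- u (- e)) *\<^sub>R e) = (\<Sum>e\<in>uminus ` E. max 0 (- u (- e)) *\<^sub>R e)"
      by (simp add: sym)
    also have "\<dots> = (\<Sum>e\<in>E. - (max 0 (- u e) *\<^sub>R e))"
      by (subst sum.reindex) auto
    finally have "(\<Sum>e\<in>E. (max 0 (u e) + max 0 (- u (- e))) *\<^sub>R e) =
        (\<Sum>e\<in>E. max 0 (u e) *\<^sub>R e - max 0 (- u e) *\<^sub>R e)"
      by (simp add: scaleR_add_left sum.distrib sum_negf sum_subtractf)
    also have "\<dots> = v"
      unfolding u by (intro sum.cong) (auto simp: max_def simp flip: scaleR_diff_left)
    finally show ?thesis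
      by (auto simp: poly_cone_def intro!: exI[of _ "\<lambda>e. max 0 (u e) + max 0 (- u (- e))"])
  qed
  then show ?thesis by blast
qed

theorem theorem4p2:
  fixes E :: "'a::banach set" and x :: "nat \<Rightarrow> 'a" and \<alpha> :: "nat \<Rightarrow> real" and n d :: nat
  assumes "\<exists>B::'a set. finite B \<and> span B = UNIV"
    and "dim (UNIV :: 'a set) = d"
    and "direction_set E"
    and "direction_reps E n x"
    and "admissible n x \<alpha>"
  shows "\<exists>\<F>. complete_fan \<F> \<and> symmetric_fan \<F> \<and> simplicial_fan \<F> \<and> E_fan E \<F> \<and>
           compatible (rho n x \<alpha>) \<F> \<and>
           (\<forall>C m. maximal_cone \<F> C \<and> (\<forall>k\<in>{1..d}. m k \<in> {1..2 * n}) \<and>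
                  C = poly_cone ((\<lambda>k. dir n x (m k)) ` {1..d}) \<longrightarrow>
             (\<forall>c. (\<forall>k\<in>{1..d}. 0 \<le> c k) \<longrightarrow>
                rho n x \<alpha> (\<Sum>k=1..d. c k *\<^sub>R dir n x (m k)) =
                  (\<Sum>k=1..d. c k * weight n \<alpha> (m k))))"
proof -
  let ?w = "rho n x \<alpha>"
  have E: "E = (\<Union>i\<in>{1..n}. {x i, - x i})"
    using assms(4) by (simp add: direction_reps_def)
  have fin: "finite E" and sym: "uminus ` E = E" and "E \<noteq> {}"
    using assms(3) by (auto simp: direction_set_def)
  then have n: "1 \<le> n" unfolding E by (cases n) auto
  have cone: "poly_cone E = UNIV"
    using symmetric_span_eq_cone[OF fin sym span_direction_set[OF assms(3)]] .
  have pos: "positive_multiindex n \<alpha>" using assms(5) by (simp add: admissible_def)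
  have w: "?w e = \<alpha> i" if "i \<in> {1..n}" "e \<in> {x i, - x i}" for i e
    using admissible_rho_generator[OF assms(5) that] .
  have w_pos: "0 < ?w e" and w_even: "?w (- e) = ?w e" if e: "e \<in> E" for e
  proof -
    obtain i where i: "i \<in> {1..n}" "e \<in> {x i, - x i}" using e unfolding E by blast
    then have "- e \<in> {x i, - x i}" by auto
    with i w show "0 < ?w e" "?w (- e) = ?w e"
      using pos by (auto simp: positive_multiindex_def)
  qed
  obtain w' where w': "\<And>e. e \<in> E \<Longrightarrow> 0 < w' e" "\<And>e. e \<in> E \<Longrightarrow> w' (- e) = w' e"
    "generic_weights E w'"
    and vertex: "\<And>f. dual_vertex E w' f \<Longrightarrow>
      \<exists>g. linear g \<and> (\<forall>e\<in>E. g e \<le> ?w e) \<and> contact_set E w' f \<subseteq> contact_set E ?w g"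
    using generic_symmetric_weights[OF fin, where w = ?w] w_pos w_even by blast
  let ?\<F> = "contact_fan E w'"
  have linear_on: "\<exists>f. linear f \<and> (\<forall>v\<in>C. ?w v = f v)" if "C \<in> ?\<F>" for C
  proof -
    obtain Y f where Y: "C = poly_cone Y" "dual_vertex E w' f" "Y \<subseteq> contact_set E w' f"
      using \<open>C \<in> ?\<F>\<close> unfolding contact_fan_def by blast
    obtain g where g: "linear g" "\<And>e. e \<in> E \<Longrightarrow> g e \<le> ?w e"
      "contact_set E w' f \<subseteq> contact_set E ?w g"
      using vertex[OF Y(2)] by blast
    have "finite (contact_set E ?w g)" using fin by (simp add: contact_set_def)
    then have "C \<subseteq> poly_cone (contact_set E ?w g)"
      unfolding Y(1) using Y(3) g(3) by (intro poly_cone_mono) auto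
    then have "\<forall>v\<in>C. ?w v = g v"
      using rho_eq_functional[OF n E pos w g(1,2)] by blast
    with g(1) show ?thesis by blast
  qed
  have dir: "?w (dir n x j) = weight n \<alpha> j" if "j \<in> {1..2 * n}" for j
    using that by (auto simp: dir_def weight_def intro!: w)
  have value_on_cone: "?w (\<Sum>k=1..d. c k *\<^sub>R dir n x (m k)) = (\<Sum>k=1..d. c k * weight n \<alpha> (m k))"
    if max: "maximal_cone ?\<F> C" and m: "\<forall>k\<in>{1..d}. m k \<in> {1..2 * n}"
      and C: "C = poly_cone ((\<lambda>k. dir n x (m k)) ` {1..d})" and c: "\<forall>k\<in>{1..d}. 0 \<le> c k"
    for C m and c :: "nat \<Rightarrow> real"
  proof -
    have "C \<in> ?\<F>" using max by (simp add: maximal_cone_def)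
    from linear_on[OF this] obtain f where f: "linear f" "\<And>v. v \<in> C \<Longrightarrow> ?w v = f v"
      by blast
    have gen: "dir n x (m k) \<in> C" if "k \<in> {1..d}" for k
      unfolding C using that by (intro poly_cone_base) auto
    have "(\<Sum>k=1..d. c k *\<^sub>R dir n x (m k)) \<in> C"
      using c gen unfolding C by (intro poly_cone_sum) auto
    from f(2)[OF this]
    have "?w (\<Sum>k=1..d. c k *\<^sub>R dir n x (m k)) = (\<Sum>k=1..d. c k * f (dir n x (m k)))"
      by (simp add: linear_sum[OF f(1)] linear_cmul[OF f(1)])
    also have "\<dots> = (\<Sum>k=1..d. c k * weight n \<alpha> (m k))"
    proof (intro sum.cong refl)
      fix k assume k: "k \<in> {1..d}"
      with m dir f(2)[OF gen[OF k]] show "c k * f (dir n x (m k)) = c k * weight n \<alpha> (m k)"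
        by simp
    qed
    finally show ?thesis .
  qed
  show ?thesis
  proof (intro exI[of _ ?\<F>] conjI allI impI)
    show "complete_fan ?\<F>" by (rule complete_contact_fan[OF fin sym cone w'(1,3)])
    show "symmetric_fan ?\<F>" by (rule symmetric_contact_fan[OF fin sym w'(2,3)])
    show "simplicial_fan ?\<F>" "E_fan E ?\<F>" by (rule fan_contact_fan[OF fin w'(3)])+
    show "compatible ?w ?\<F>" unfolding compatible_def using linear_on by blast
  qed (use value_on_cone in blast)
qed

end
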